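(* Let $\{\mu_n\}_{n\ge\tau_0}$ be a sequence of empirical measures defined by the $\mathbb{Z}$-urn with any initial configuration. Suppose $Z_n\sim\mu_n$ is a random draw from the urn at time $n$. Let $$A=\lim_{n\to\infty}\frac{\mathbb{E}[Z_n\mid\mu_n]}{n+1}.$$ Then $A$ exists almost surely, $\mathbb{P}(A\neq 0)>0$, and (quenched statement: for almost every realization of the urn process) $$\lim_{n\to\infty}\mathcal{L}\left(\frac{Z_n}{n}\,\Big|\,\mu_n\right)=\mathcal{L}(Z)$$ in the sense of weak convergence of probability measures on $\mathbb{R}$, where $Z\sim A\cdot\mathrm{Exp}(1)$; that is, with the value of $A$ fixed by the realization of the urn, $\mathcal{L}(Z)$ is the law of $A\cdot E$ with $E$ a rate-one exponential random variable.
   Context: The $\mathbb{Z}$-urn: the urn initially contains a finite nonempty collection (with multiplicity) of $\tau_0\ge 1$ balls with integer labels, written $X_1,\dots,X_{\tau_0}$; this collection is the initial configuration. Time is indexed so that at time $n\ge\tau_0$ there are exactly $n$ balls in the urn. At each time $n\ge\tau_0$, two balls are drawn independently, uniformly at random and with replacement from the $n$ balls, and a new ball is added whose label $X_{n+1}$ is the sum of the two drawn labels. The drawn balls remain in the urn. The empirical measure at time $n$ is $\mu_n=\frac1n\sum_{i=1}^n\delta_{X_i}$. Thus, conditionally on the urn process up to time $n$, $X_{n+1}=Z_n^1+Z_n^2$ with $Z_n^1,Z_n^2$ independent with law $\mu_n$. Quenched convention: the realization of the urn process $\{\mu_n\}$ is fixed and $Z_n$ is sampled from $\mu_n$, so $\mathcal{L}(Z_n\mid\mu_n)=\mu_n$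 and $\mathbb{E}[Z_n\mid\mu_n]=S_n/n$ with $S_n=\sum_{i=1}^nX_i$. $\mathcal{L}(\cdot)$ denotes the law of a random variable.
   Formalization: The claim P(A ≠ 0) > 0 is stated only for initial configurations with at least one nonzero label; if all initial labels are 0, every later label is 0 and A = 0, so the claim fails there. The other claims are for every initial configuration. *)

theory Defs
  imports "HOL-Probability.Probability"
begin

text \<open>
  Time \<open>n\<close> means that the urn holds the balls \<open>1, \<dots>, n\<close>, ball \<open>i\<close> carrying the label \<open>X i\<close>
  (\<open>X 0\<close> is junk). \<open>D n False\<close> and \<open>D n True\<close> are the indices of the two balls drawn at time \<open>n\<close>.
  Since the initial labels are deterministic, mutual independence of all draws makes the two
  draws at time \<open>n\<close> independent of the history of the urn up to time \<open>n\<close>.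
\<close>

locale Z_urn = prob_space M for M :: "'a measure" +
  fixes \<tau>\<^sub>0 :: nat
    and x\<^sub>0 :: "nat \<Rightarrow> int"
    and D :: "nat \<Rightarrow> bool \<Rightarrow> 'a \<Rightarrow> nat"
    and X :: "nat \<Rightarrow> 'a \<Rightarrow> int"
  assumes initial_size: "1 \<le> \<tau>\<^sub>0"
    and label_measurable: "\<And>i. random_variable (count_space UNIV) (X i)"
    and initial_label: "\<And>i. i \<in> {1..\<tau>\<^sub>0} \<Longrightarrow> AE \<omega> in M. X i \<omega> = x\<^sub>0 i"
    and draws_indep:
      "indep_vars (\<lambda>_. count_space UNIV) (\<lambda>(n, b). D n b) ({\<tau>\<^sub>0..} \<times> UNIV)"
    and draw_uniform:
      "\<And>n b. \<tau>\<^sub>0 \<le> n \<Longrightarrow> distr M (count_space UNIV) (D n b) = measure_pmf (pmf_of_set {1..n})"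
    and new_label:
      "\<And>n. \<tau>\<^sub>0 \<le> n \<Longrightarrow>
        AE \<omega> in M. X (n + 1) \<omega> = X (D n False \<omega>) \<omega> + X (D n True \<omega>) \<omega>"

text \<open>
  The following notions are quenched: they take one realization \<open>x\<close> of the sequence of labels.
  They are meaningful for \<open>n \<ge> 1\<close> only, as \<open>pmf_of_set {}\<close> is unspecified.
\<close>

definition empirical :: "(nat \<Rightarrow> int) \<Rightarrow> nat \<Rightarrow> int pmf" where
  "empirical x n = map_pmf x (pmf_of_set {1..n})"

lemma measure_empirical:
  assumes "n \<ge> 1"
  shows "measure (empirical x n) B = (\<Sum>i=1..n. indicator B (x i)) / real n"
proof -
  have "measure (empirical x n) B = real (card ({1..n} \<inter> x -` B)) / real n"
    using assms by (simp add: empirical_def measure_pmf_of_set)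
  also have "real (card ({1..n} \<inter> x -` B)) = (\<Sum>i=1..n. indicator (x -` B) i)"
    by (simp add: indicator_def sum.If_cases Int_def vimage_def)
  finally show ?thesis
    by (simp add: indicator_def)
qed

definition draw_mean :: "(nat \<Rightarrow> int) \<Rightarrow> nat \<Rightarrow> real" where
  "draw_mean x n = measure_pmf.expectation (empirical x n) real_of_int"

definition scaled_draw_law :: "(nat \<Rightarrow> int) \<Rightarrow> nat \<Rightarrow> real measure" where
  "scaled_draw_law x n =
     distr (measure_pmf (empirical x n)) borel (\<lambda>z. real_of_int z / real n)"

definition urn_slope :: "(nat \<Rightarrow> int) \<Rightarrow> real" where
  "urn_slope x = lim (\<lambda>n. draw_mean x n / real (n + 1))"

text \<open>The law of \<open>a * E\<close> with \<open>E\<close> exponential of rate one; it is the point mass at 0 if \<open>a = 0\<close>.\<close>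

definition scaled_exp_law :: "real \<Rightarrow> real measure" where
  "scaled_exp_law a =
     distr (density lborel (exponential_density 1)) borel (\<lambda>t. a * t)"

end

theory Submission
  imports Defs
begin

text \<open>
  Write \<open>S n\<close> for the sum of the first \<open>n\<close> labels. Given these labels, the next one has conditional
  mean \<open>2 * S n / n\<close>, so \<open>S n / (n * (n + 1))\<close> is a martingale, and its limit is the slope \<open>A\<close>. The conditional second moment of a new label is a
  combination of \<open>(S n)\<^sup>2\<close> and of the sum of squares of the labels, which gives a closed linear
  recursion with the conclusion that a new label has second moment \<open>O(n\<^sup>2)\<close> (\<open>moment_growth\<close>). The
  martingale increments therefore have variance \<open>O(1 / n\<^sup>2)\<close>, and Kolmogorov's maximal inequality
  gives almost sure convergence. The second moment of the martingale never decreases and is positive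
  after one draw unless all initial labels vanish, while the tail variances tend to 0; hence the
  limit cannot vanish almost surely (\<open>not_AE_slope_tendsto_0\<close>).

  For the limit law, fix a frequency \<open>\<theta>\<close> and let \<open>\<phi> n\<close> be the characteristic function of the
  empirical measure at \<open>\<theta>\<close>. A sum of two independent draws has characteristic function \<open>(\<phi> n)\<^sup>2\<close>, so
  \<open>n * \<phi> n\<close> grows by \<open>(\<phi> n)\<^sup>2\<close> plus a bounded martingale difference. Without the noise this is a
  discretization of an equation solved by \<open>\<psi> n = 1 / (1 - \<i> * a * n)\<close>, which is the characteristic
  function of \<open>a * n * E\<close> with \<open>E\<close> exponential of rate one. The free constant \<open>a\<close> is found at times \<open>n\<close>
  for which \<open>\<theta> * n\<close> is small: there \<open>\<phi> n\<close> is about \<open>1 + \<i> * \<theta> * S n / n\<close>, hence \<open>a = \<theta> * A\<close>. The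
  recursion is stable: errors of \<open>n * \<phi> n\<close> present at time \<open>m\<close> are amplified up to time \<open>N\<close> by at
  most \<open>(N / m)\<^sup>2\<close> (\<open>urn_char_stability\<close>).

  To read off the law of \<open>Z N / N\<close> at frequency \<open>t\<close>, take \<open>\<theta> = t / N\<close> and run the recursion from \<open>m\<close> to
  \<open>N\<close> with \<open>m = L ^ 13\<close> and \<open>N = L ^ 16\<close>. These exponents let all error terms vanish and make the
  exceptional probabilities summable over \<open>L\<close>, using second moments only. Neighbouring powers
  \<open>L ^ 16\<close> have ratio tending to 1, so convergence along them passes to all \<open>N\<close>; almost surely it
  holds for all rational \<open>t\<close> at once, and extends to real \<open>t\<close> because the mean of the absolute labels
  grows at most linearly. Levy's continuity theorem concludes.
\<close>

section \<open>Noise and label sums along a path\<close>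

text \<open>
  The conditional expectation of \<open>f\<close> applied to the next label, given the labels up to time \<open>n\<close>.
\<close>

definition pair_mean :: "(int \<Rightarrow> real) \<Rightarrow> nat \<Rightarrow> (nat \<Rightarrow> int) \<Rightarrow> real" where
  "pair_mean f n x = (\<Sum>i=1..n. \<Sum>j=1..n. f (x i + x j)) / (real n)\<^sup>2"

definition noise :: "(int \<Rightarrow> real) \<Rightarrow> nat \<Rightarrow> (nat \<Rightarrow> int) \<Rightarrow> real" where
  "noise f n x = f (x (Suc n)) - pair_mean f n x"

definition noise_sum :: "(nat \<Rightarrow> int \<Rightarrow> real) \<Rightarrow> nat \<Rightarrow> nat \<Rightarrow> (nat \<Rightarrow> int) \<Rightarrow> real" where
  "noise_sum f m n x = (\<Sum>j=m..<n. noise (f j) j x)"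

lemma noise_sum_Suc: "m \<le> n \<Longrightarrow> noise_sum f m (Suc n) x = noise_sum f m n x + noise (f n) n x"
  by (simp add: noise_sum_def)

lemma noise_sum_self [simp]: "noise_sum f m m x = 0"
  by (simp add: noise_sum_def)

lemma pair_mean_divide: "pair_mean (\<lambda>z. f z / c) n x = pair_mean f n x / c"
  by (simp add: pair_mean_def sum_divide_distrib[symmetric] divide_simps)

definition label_sum :: "nat \<Rightarrow> (nat \<Rightarrow> int) \<Rightarrow> real" where
  "label_sum n x = (\<Sum>i=1..n. real_of_int (x i))"

definition abs_sum :: "nat \<Rightarrow> (nat \<Rightarrow> int) \<Rightarrow> real" where
  "abs_sum n x = (\<Sum>i=1..n. \<bar>real_of_int (x i)\<bar>)"

definition square_sum :: "nat \<Rightarrow> (nat \<Rightarrow> int) \<Rightarrow> real" where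
  "square_sum n x = (\<Sum>i=1..n. (real_of_int (x i))\<^sup>2)"

lemma label_sum_Suc: "label_sum (Suc n) x = label_sum n x + x (Suc n)"
  and abs_sum_Suc: "abs_sum (Suc n) x = abs_sum n x + \<bar>real_of_int (x (Suc n))\<bar>"
  and square_sum_Suc: "square_sum (Suc n) x = square_sum n x + (real_of_int (x (Suc n)))\<^sup>2"
  by (simp_all add: label_sum_def abs_sum_def square_sum_def)

lemma pair_mean_label:
  "pair_mean (\<lambda>z. real_of_int z) n x = 2 * label_sum n x / n"
proof -
  have "(\<Sum>i=1..n. \<Sum>j=1..n. real_of_int (x i + x j)) = 2 * n * label_sum n x"
    by (simp add: label_sum_def sum.distrib sum_distrib_left mult.assoc)
  thus ?thesis by (simp add: pair_mean_def power2_eq_square)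
qed

lemma pair_mean_abs_le:
  "pair_mean (\<lambda>z. \<bar>real_of_int z\<bar>) n x \<le> 2 * abs_sum n x / n"
proof -
  have "(\<Sum>i=1..n. \<Sum>j=1..n. \<bar>real_of_int (x i + x j)\<bar>)
      \<le> (\<Sum>i=1..n. \<Sum>j=1..n. \<bar>real_of_int (x i)\<bar> + \<bar>real_of_int (x j)\<bar>)"
    by (intro sum_mono) (simp add: abs_triangle_ineq)
  also have "\<dots> = 2 * n * abs_sum n x"
    by (simp add: abs_sum_def sum.distrib sum_distrib_left mult.assoc)
  finally have "pair_mean (\<lambda>z. \<bar>real_of_int z\<bar>) n x \<le> 2 * n * abs_sum n x / (real n)\<^sup>2"
    unfolding pair_mean_def by (rule divide_right_mono) simp
  thus ?thesis by (cases "n = 0") (simp_all add: power2_eq_square)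
qed

lemma pair_mean_square:
  assumes "n \<ge> 1"
  shows "pair_mean (\<lambda>z. (real_of_int z)\<^sup>2) n x = 2 / n * square_sum n x + 2 / (real n)\<^sup>2 * (label_sum n x)\<^sup>2"
proof -
  have "(\<Sum>i=1..n. \<Sum>j=1..n. (real_of_int (x i + x j))\<^sup>2)
      = (\<Sum>i=1..n. \<Sum>j=1..n. (real_of_int (x i))\<^sup>2 + (real_of_int (x j))\<^sup>2 + 2 * (real_of_int (x i) * real_of_int (x j)))"
    by (intro sum.cong refl) (simp add: power2_eq_square algebra_simps)
  also have "\<dots> = 2 * n * square_sum n x + 2 * (label_sum n x * label_sum n x)"
    unfolding label_sum_def sum_product square_sum_def
    by (simp add: sum.distrib sum_distrib_left mult.assoc)
  finally show ?thesis using assms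
    by (simp add: pair_mean_def power2_eq_square field_simps)
qed

text \<open>
  For positive \<open>n\<close> this is the sequence whose limit is the slope of the urn.
\<close>

definition slope :: "nat \<Rightarrow> (nat \<Rightarrow> int) \<Rightarrow> real" where
  "slope n x = label_sum n x / (real n * (real n + 1))"

text \<open>
  With this normalization of the noise the conditional mean \<open>2 * label_sum n x / n\<close> of the next label
  is exactly the drift that keeps the slope constant.
\<close>

definition slope_noise :: "nat \<Rightarrow> int \<Rightarrow> real" where
  "slope_noise j z = real_of_int z / ((real j + 1) * (real j + 2))"

lemma slope_Suc:
  assumes "n \<ge> 1"
  shows "slope (Suc n) x = slope n x + noise (slope_noise n) n x"
proof -
  have n: "real n \<ge> 1" using assms by simp
  have "noise (slope_noise n) n x
      = (real_of_int (x (Suc n)) - 2 * label_sum n x / n) / ((real n + 1) * (real n + 2))"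
    by (simp add: noise_def slope_noise_def[abs_def] pair_mean_divide pair_mean_label diff_divide_distrib)
  moreover have "label_sum n x / (real n * (real n + 1))
      = (label_sum n x + 2 * label_sum n x / n) / ((real n + 1) * (real n + 2))"
    using n by (simp add: divide_simps) (simp add: algebra_simps)
  ultimately show ?thesis
    by (simp add: slope_def label_sum_Suc add_divide_distrib[symmetric] algebra_simps)
qed

lemma slope_eq_noise_sum:
  assumes "1 \<le> m" "m \<le> n"
  shows "slope n x = slope m x + noise_sum slope_noise m n x"
  using assms(2)
proof (induction n rule: dec_induct)
  case (step n)
  thus ?case using assms(1) by (simp add: slope_Suc noise_sum_Suc)
qed simp

section \<open>Functions of the urn's history\<close>

text \<open>
  Measurability with respect to the first \<open>n\<close> labels. As labels are discrete, this pointwise notion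
  stands in for the filtration of the urn.
\<close>

definition depends_on :: "nat \<Rightarrow> ((nat \<Rightarrow> int) \<Rightarrow> 'b) \<Rightarrow> bool" where
  "depends_on n g \<longleftrightarrow> (\<forall>x y. (\<forall>i\<in>{1..n}. x i = y i) \<longrightarrow> g x = g y)"

lemma depends_onD: "depends_on n g \<Longrightarrow> (\<And>i. \<lbrakk>1 \<le> i; i \<le> n\<rbrakk> \<Longrightarrow> x i = y i) \<Longrightarrow> g x = g y"
  by (auto simp: depends_on_def)

lemma depends_on_mono: "depends_on n g \<Longrightarrow> n \<le> m \<Longrightarrow> depends_on m g"
  unfolding depends_on_def by auto

lemma depends_on_combine:
  "depends_on n g \<Longrightarrow> depends_on n h \<Longrightarrow> depends_on n (\<lambda>x. F (g x) (h x))"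
  unfolding depends_on_def by metis

lemmas depends_on_diff = depends_on_combine[where F = "(-)"]

lemmas depends_on_times = depends_on_combine[where F = "(*)"]

lemma depends_on_square: "depends_on n g \<Longrightarrow> depends_on n (\<lambda>x. (g x)\<^sup>2)"
  unfolding depends_on_def by metis

lemma depends_on_next_label: "depends_on (Suc n) (\<lambda>x. f (x (Suc n)))"
  by (simp add: depends_on_def)

lemma depends_on_pair_mean: "depends_on n (pair_mean f n)"
  by (auto simp: depends_on_def pair_mean_def)

lemma depends_on_noise: "depends_on (Suc n) (noise f n)"
  unfolding noise_def
  by (intro depends_on_diff depends_on_next_label
        depends_on_mono[OF depends_on_pair_mean]) auto

lemma depends_on_noise_sum:
  assumes "n \<le> k" shows "depends_on k (noise_sum f m n)"
  unfolding depends_on_def noise_sum_def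
  by (intro allI impI sum.cong refl depends_onD[OF depends_on_noise]) (use assms in auto)

lemma depends_on_label_sum: "depends_on n (label_sum n)"
  and depends_on_square_sum: "depends_on n (square_sum n)"
  by (auto simp: depends_on_def label_sum_def square_sum_def)

lemma depends_on_slope: "depends_on n (slope n)"
  using depends_on_combine[OF depends_on_label_sum depends_on_label_sum, where F = "\<lambda>a _. a / (real n * (real n + 1))"]
  by (simp add: slope_def[abs_def])

text \<open>
  Labels are countable, so fixing the value of the last label reduces \<open>n + 1\<close> coordinates to \<open>n\<close>.
\<close>

lemma measurable_depends_on:
  fixes g :: "(nat \<Rightarrow> int) \<Rightarrow> real"
  assumes f: "\<And>i. f i \<in> N \<rightarrow>\<^sub>M count_space UNIV" and "depends_on n g"
  shows "(\<lambda>\<omega>. g (\<lambda>i. f i \<omega>)) \<in> borel_measurable N"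
  using assms(2)
proof (induction n arbitrary: g)
  case 0
  hence "(\<lambda>\<omega>. g (\<lambda>i. f i \<omega>)) = (\<lambda>_. g (\<lambda>_. 0))"
    by (intro ext depends_onD[OF 0]) auto
  thus ?case by simp
next
  case (Suc n)
  have "(\<lambda>\<omega>. g ((\<lambda>i. f i \<omega>)(Suc n := z))) \<in> borel_measurable N" for z
    by (rule Suc.IH[of "\<lambda>x. g (x(Suc n := z))"], unfold depends_on_def, intro allI impI depends_onD[OF Suc.prems])
       (auto simp: le_Suc_eq)
  from measurable_compose_countable[where f = "\<lambda>z \<omega>. g ((\<lambda>i. f i \<omega>)(Suc n := z))", OF this f[of "Suc n"]]
  show ?case by (simp add: fun_upd_idem)
qed

text \<open>
  The labels at time \<open>n\<close> recomputed from the draws alone, \<open>t\<close> being the initial size. This exhibits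
  the history as a function of the draws before time \<open>n\<close>, to which their independence applies.
\<close>

primrec simulate :: "nat \<Rightarrow> (nat \<Rightarrow> int) \<Rightarrow> (nat \<times> bool \<Rightarrow> nat) \<Rightarrow> nat \<Rightarrow> nat \<Rightarrow> int" where
  "simulate t x0 d 0 = x0"
| "simulate t x0 d (Suc n) =
     (if n < t then simulate t x0 d n
      else (simulate t x0 d n)
        (Suc n := simulate t x0 d n (d (n, False)) + simulate t x0 d n (d (n, True))))"

lemma simulate_initial: "n \<le> t \<Longrightarrow> simulate t x0 d n = x0"
  by (induction n) auto

lemma measurable_simulate:
  "n \<le> m \<Longrightarrow> (\<lambda>d. simulate t x0 d n i)
     \<in> PiM ({t..<m} \<times> UNIV) (\<lambda>_. count_space UNIV) \<rightarrow>\<^sub>M count_space UNIV"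
proof (induction n arbitrary: i)
  case (Suc n)
  show ?case
  proof (cases "n < t \<or> i \<noteq> Suc n")
    case False
    have "(\<lambda>d. d (n, b)) \<in> PiM ({t..<m} \<times> UNIV) (\<lambda>_. count_space UNIV) \<rightarrow>\<^sub>M count_space UNIV" for b :: bool
      using False Suc.prems by (intro measurable_component_singleton) auto
    hence *: "(\<lambda>d. simulate t x0 d n (d (n, b)))
        \<in> PiM ({t..<m} \<times> UNIV) (\<lambda>_. count_space UNIV) \<rightarrow>\<^sub>M count_space UNIV" for b
      by (rule measurable_compose_countable[where f = "\<lambda>i d. simulate t x0 d n i", rotated])
         (rule Suc.IH, use Suc.prems in simp)
    show ?thesis using False *[of False] *[of True] by simp
  next
    case True
    hence "simulate t x0 d (Suc n) i = simulate t x0 d n i" for d by auto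
    thus ?thesis using Suc by simp
  qed
qed auto

section \<open>Conditioning on the history\<close>

context Z_urn
begin

definition path :: "'a \<Rightarrow> nat \<Rightarrow> int" where "path \<omega> = (\<lambda>i. X i \<omega>)"

lemma measurable_path_depends:
  fixes g :: "(nat \<Rightarrow> int) \<Rightarrow> real"
  assumes "depends_on n g" shows "(\<lambda>\<omega>. g (path \<omega>)) \<in> borel_measurable M"
  using measurable_depends_on[OF label_measurable assms] by (simp add: path_def)

lemma measurable_draw:
  assumes "\<tau>\<^sub>0 \<le> n" shows "random_variable (count_space UNIV) (D n b)"
  using draws_indep assms unfolding indep_vars_def by auto

lemma AE_draw_range: "\<tau>\<^sub>0 \<le> n \<Longrightarrow> AE \<omega> in M. D n b \<omega> \<in> {1..n}"
proof -
  assume n: "\<tau>\<^sub>0 \<le> n"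
  hence "set_pmf (pmf_of_set {1..n}) = {1..n}" using initial_size by (intro set_pmf_of_set) auto
  hence "AE i in distr M (count_space UNIV) (D n b). i \<in> {1..n}"
    unfolding draw_uniform[OF n] by (auto simp: AE_measure_pmf_iff)
  thus ?thesis by (subst (asm) AE_distr_iff[OF measurable_draw[OF n]]) auto
qed

lemma AE_path_simulate:
  "\<tau>\<^sub>0 \<le> n \<Longrightarrow> AE \<omega> in M. \<forall>i\<in>{1..n}. path \<omega> i = simulate \<tau>\<^sub>0 x\<^sub>0 (\<lambda>(k, b). D k b \<omega>) n i"
proof (induction n rule: dec_induct)
  case base
  show ?case using initial_label
    by (auto simp: simulate_initial AE_ball_countable path_def)
next
  case (step n)
  show ?case
    using step.IH new_label[OF step.hyps(1)] AE_draw_range[OF step.hyps(1), of False]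
      AE_draw_range[OF step.hyps(1), of True]
  proof eventually_elim
    case (elim \<omega>)
    have "path \<omega> (D n b \<omega>) = simulate \<tau>\<^sub>0 x\<^sub>0 (\<lambda>(k, b). D k b \<omega>) n (D n b \<omega>)" for b
      using elim by (cases b) auto
    hence "path \<omega> (Suc n) = simulate \<tau>\<^sub>0 x\<^sub>0 (\<lambda>(k, b). D k b \<omega>) (Suc n) (Suc n)"
      using elim(2) step.hyps(1) by (simp add: path_def)
    moreover have "path \<omega> i = simulate \<tau>\<^sub>0 x\<^sub>0 (\<lambda>(k, b). D k b \<omega>) (Suc n) i" if "i \<in> {1..n}" for i
      using elim(1) that step.hyps(1) by simp
    ultimately show ?case by (metis atLeastAtMost_iff le_Suc_eq)
  qed
qed

lemma prob_draw: 
  assumes "\<tau>\<^sub>0 \<le> n" "i \<in> {1..n}"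
  shows "prob {\<omega> \<in> space M. D n b \<omega> = i} = 1 / n"
proof -
  have "prob {\<omega> \<in> space M. D n b \<omega> = i} = measure (distr M (count_space UNIV) (D n b)) {i}"
    by (subst measure_distr[OF measurable_draw[OF assms(1)]]) (simp_all add: vimage_def Int_def conj_commute)
  also have "\<dots> = 1 / n"
    unfolding draw_uniform[OF assms(1)] using assms by (simp add: measure_pmf_of_set Int_absorb1)
  finally show ?thesis .
qed

lemma prob_draw_pair:
  assumes "\<tau>\<^sub>0 \<le> n" "i \<in> {1..n}" "j \<in> {1..n}"
  shows "prob {\<omega> \<in> space M. D n False \<omega> = i \<and> D n True \<omega> = j} = 1 / (real n)\<^sup>2"
proof -
  let ?A = "\<lambda>(k::nat, b). if b then {j} else {i}"
  have "prob (\<Inter>p\<in>{(n, False), (n, True)}. (\<lambda>(n, b). D n b) p -` ?A p \<inter> space M)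
      = (\<Prod>p\<in>{(n, False), (n, True)}. prob ((\<lambda>(n, b). D n b) p -` ?A p \<inter> space M))"
    by (rule indep_varsD[OF draws_indep]) (use assms in auto)
  also have "(\<Inter>p\<in>{(n, False), (n, True)}. (\<lambda>(n, b). D n b) p -` ?A p \<inter> space M)
      = {\<omega> \<in> space M. D n False \<omega> = i \<and> D n True \<omega> = j}"
    by auto
  also have "(\<Prod>p\<in>{(n, False), (n, True)}. prob ((\<lambda>(n, b). D n b) p -` ?A p \<inter> space M))
    = prob {\<omega> \<in> space M. D n False \<omega> = i} * prob {\<omega> \<in> space M. D n True \<omega> = j}"
    by (simp add: vimage_def Int_def conj_commute)
  also have "\<dots> = 1 / (real n)\<^sup>2"
    unfolding prob_draw[OF assms(1,2)] prob_draw[OF assms(1,3)] by (simp add: power2_eq_square)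
  finally show ?thesis .
qed

lemma expectation_history_draw:
  fixes h :: "(nat \<Rightarrow> int) \<Rightarrow> real"
  assumes n: "\<tau>\<^sub>0 \<le> n" and h: "depends_on n h" and ij: "i \<in> {1..n}" "j \<in> {1..n}"
    and int: "integrable M (\<lambda>\<omega>. h (path \<omega>))"
  shows "expectation (\<lambda>\<omega>. h (path \<omega>) * of_bool (D n False \<omega> = i \<and> D n True \<omega> = j))
    = expectation (\<lambda>\<omega>. h (path \<omega>)) / (real n)\<^sup>2"
proof -
  let ?D = "\<lambda>p \<omega>. (\<lambda>(n, b). D n b) p \<omega>" and ?C = "\<lambda>_::nat\<times>bool. count_space (UNIV::nat set)"
  let ?I = "{\<tau>\<^sub>0..<n} \<times> (UNIV::bool set)" and ?J = "{n} \<times> (UNIV::bool set)"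
  let ?h = "\<lambda>d. h (simulate \<tau>\<^sub>0 x\<^sub>0 d n)"
  let ?k = "\<lambda>d. of_bool (d (n, False) = i \<and> d (n, True) = j) :: real"
  have indep: "indep_var (PiM ?I ?C) (\<lambda>\<omega>. restrict (\<lambda>p. ?D p \<omega>) ?I) (PiM ?J ?C) (\<lambda>\<omega>. restrict (\<lambda>p. ?D p \<omega>) ?J)"
    by (rule indep_var_restrict[OF draws_indep]) (use n in auto)
  have mh: "?h \<in> borel_measurable (PiM ?I ?C)"
    by (rule measurable_depends_on[where f = "\<lambda>i d. simulate \<tau>\<^sub>0 x\<^sub>0 d n i", OF measurable_simulate h]) simp
  have mk: "?k \<in> borel_measurable (PiM ?J ?C)"
  proof -
    have "(\<lambda>d. d (n, b)) \<in> PiM ?J ?C \<rightarrow>\<^sub>M count_space UNIV" for b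
      by (rule measurable_component_singleton) simp
    from measurable_Pair[OF this[of False] this[of True]]
    have "(\<lambda>d. (d (n, False), d (n, True))) \<in> PiM ?J ?C \<rightarrow>\<^sub>M count_space UNIV"
      by (simp add: pair_measure_countable)
    from measurable_compose[OF this, of "\<lambda>p. of_bool (fst p = i \<and> snd p = j) :: real" borel]
    show ?thesis by simp
  qed
  \<comment> \<open>\<open>H\<close> and \<open>K\<close> are the two factors written as functions of disjoint families of draws.\<close>
  define H where "H = ?h \<circ> (\<lambda>\<omega>. restrict (\<lambda>p. ?D p \<omega>) ?I)"
  define K where "K = ?k \<circ> (\<lambda>\<omega>. restrict (\<lambda>p. ?D p \<omega>) ?J)"
  have ind: "indep_var borel H borel K"
    unfolding H_def K_def by (rule indep_var_compose[OF indep mh mk])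
  have [measurable]: "random_variable borel H" "random_variable borel K"
    by (rule indep_var_rv1[OF ind], rule indep_var_rv2[OF ind])
  have [measurable]: "(\<lambda>\<omega>. h (path \<omega>)) \<in> borel_measurable M"
    by (rule measurable_path_depends[OF h])
  have restrict_I: "simulate \<tau>\<^sub>0 x\<^sub>0 (restrict d ?I) m = simulate \<tau>\<^sub>0 x\<^sub>0 d m" if "m \<le> n" for d m
    using that by (induction m) (auto simp: fun_eq_iff)
  have ae: "AE \<omega> in M. h (path \<omega>) = H \<omega>"
    using AE_path_simulate[OF n]
    by eventually_elim
       (auto simp: H_def restrict_I split_beta' intro!: depends_onD[OF h])
  have K: "K \<omega> = of_bool (D n False \<omega> = i \<and> D n True \<omega> = j)" for \<omega>
    by (simp add: K_def)
  have int1: "integrable M H"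
    using ae int integrable_cong_AE[of "\<lambda>\<omega>. h (path \<omega>)" M H] by simp
  have int2: "integrable M K"
    by (rule integrable_const_bound[where B = 1]) (simp_all add: K)
  have "expectation (\<lambda>\<omega>. h (path \<omega>) * of_bool (D n False \<omega> = i \<and> D n True \<omega> = j))
     = expectation (\<lambda>\<omega>. h (path \<omega>) * K \<omega>)"
    by (simp add: K)
  also have "\<dots> = expectation (\<lambda>\<omega>. H \<omega> * K \<omega>)"
    by (rule integral_cong_AE) (use ae in auto)
  also have "\<dots> = expectation H * expectation K"
    by (rule indep_var_lebesgue_integral[OF ind int1 int2])
  also have "expectation H = expectation (\<lambda>\<omega>. h (path \<omega>))"
    by (rule integral_cong_AE) (use ae in auto)
  also have "expectation K = expectation (indicator {\<omega> \<in> space M. D n False \<omega> = i \<and> D n True \<omega> = j})"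
    by (rule Bochner_Integration.integral_cong) (auto simp: K)
  also have "\<dots> = 1 / (real n)\<^sup>2"
    using prob_draw_pair[OF n ij] by (simp add: Int_def conj_commute)
  finally show ?thesis by simp
qed

lemma AE_path_bounded: "\<tau>\<^sub>0 \<le> n \<Longrightarrow> \<exists>B. AE \<omega> in M. \<forall>i\<in>{1..n}. \<bar>path \<omega> i\<bar> \<le> B"
proof (induction n rule: dec_induct)
  case base
  have "AE \<omega> in M. \<forall>i\<in>{1..\<tau>\<^sub>0}. path \<omega> i = x\<^sub>0 i"
    using initial_label by (auto simp: AE_ball_countable path_def)
  hence "AE \<omega> in M. \<forall>i\<in>{1..\<tau>\<^sub>0}. \<bar>path \<omega> i\<bar> \<le> (\<Sum>i=1..\<tau>\<^sub>0. \<bar>x\<^sub>0 i\<bar>)"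
    by eventually_elim (auto intro!: member_le_sum)
  thus ?case by blast
next
  case (step n)
  then obtain B where B: "AE \<omega> in M. \<forall>i\<in>{1..n}. \<bar>path \<omega> i\<bar> \<le> B" by blast
  have "AE \<omega> in M. \<forall>i\<in>{1..Suc n}. \<bar>path \<omega> i\<bar> \<le> 2 * B"
    using B new_label[OF step.hyps(1)] AE_draw_range[OF step.hyps(1), of False]
      AE_draw_range[OF step.hyps(1), of True]
  proof eventually_elim
    case (elim \<omega>)
    have "\<bar>path \<omega> (D n b \<omega>)\<bar> \<le> B" for b using elim by (cases b) auto
    from this[of False] this[of True] have "\<bar>path \<omega> (Suc n)\<bar> \<le> 2 * B" and "B \<ge> 0"
      using elim(2) by (auto simp: path_def)
    thus ?case using elim(1) by (force simp: atLeastAtMostSuc_conv)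
  qed
  thus ?case by blast
qed

lemma integrable_path_depends:
  fixes g :: "(nat \<Rightarrow> int) \<Rightarrow> real"
  assumes g: "depends_on n g"
  shows "integrable M (\<lambda>\<omega>. g (path \<omega>))"
proof -
  obtain B where B: "AE \<omega> in M. \<forall>i\<in>{1..max n \<tau>\<^sub>0}. \<bar>path \<omega> i\<bar> \<le> B"
    using AE_path_bounded[of "max n \<tau>\<^sub>0"] by auto
  define F where "F = PiE {1..n} (\<lambda>_. {-B..B})"
  have F: "finite F" by (auto simp: F_def intro!: finite_PiE)
  from B have "AE \<omega> in M. \<bar>g (path \<omega>)\<bar> \<le> Max ((\<lambda>x. \<bar>g x\<bar>) ` F)"
  proof eventually_elim
    case (elim \<omega>)
    have "restrict (path \<omega>) {1..n} \<in> F" using elim by (force simp: F_def abs_le_iff)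
    moreover have "g (path \<omega>) = g (restrict (path \<omega>) {1..n})" by (rule depends_onD[OF g]) auto
    ultimately show ?case using F by (auto intro!: Max_ge)
  qed
  thus ?thesis
    by (intro integrable_const_bound measurable_path_depends[OF g]) auto
qed

text \<open>
  The Markov property of the urn: the history splits according to which of the equally likely pairs
  of balls is drawn, and each pair is independent of the history.
\<close>

lemma expectation_step:
  fixes g :: "(nat \<Rightarrow> int) \<Rightarrow> real"
  assumes n: "\<tau>\<^sub>0 \<le> n" and g: "depends_on (Suc n) g"
  shows "expectation (\<lambda>\<omega>. g (path \<omega>)) =
    expectation (\<lambda>\<omega>. (\<Sum>i=1..n. \<Sum>j=1..n. g ((path \<omega>)(Suc n := path \<omega> i + path \<omega> j))) / (real n)\<^sup>2)"
proof -
  let ?G = "\<lambda>i j x. g (x(Suc n := x i + x j))"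
  let ?U = "\<lambda>i j \<omega>. of_bool (D n False \<omega> = i \<and> D n True \<omega> = j) :: real"
  have G: "depends_on n (?G i j)" if "i \<in> {1..n}" "j \<in> {1..n}" for i j
    unfolding depends_on_def
  proof (intro allI impI)
    fix x y :: "nat \<Rightarrow> int" assume xy: "\<forall>i\<in>{1..n}. x i = y i"
    show "?G i j x = ?G i j y" by (rule depends_onD[OF g]) (use xy that in auto)
  qed
  have [measurable]: "random_variable (count_space UNIV) (D n b)" for b
    by (rule measurable_draw[OF n])
  have int: "integrable M (\<lambda>\<omega>. ?G i j (path \<omega>) * ?U i j \<omega>)" if "i \<in> {1..n}" "j \<in> {1..n}" for i j
    by (rule Bochner_Integration.integrable_bound[OF integrable_path_depends[OF G[OF that]]])
       (use measurable_path_depends[OF G[OF that]] in auto)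
  have "AE \<omega> in M. g (path \<omega>) = (\<Sum>i=1..n. \<Sum>j=1..n. ?G i j (path \<omega>) * ?U i j \<omega>)"
    using new_label[OF n] AE_draw_range[OF n, of False] AE_draw_range[OF n, of True]
  proof eventually_elim
    case (elim \<omega>)
    have "(\<Sum>j=1..n. ?G i j (path \<omega>) * ?U i j \<omega>)
        = (if i = D n False \<omega> then ?G i (D n True \<omega>) (path \<omega>) else 0)" for i
    proof -
      have "(\<Sum>j=1..n. ?G i j (path \<omega>) * ?U i j \<omega>) = (\<Sum>j=1..n. if j = D n True \<omega> then 
        (if i = D n False \<omega> then ?G i (D n True \<omega>) (path \<omega>) else 0) else 0)"
        by (intro sum.cong) auto
      thus ?thesis using elim by simp
    qed
    hence sum_eq: "(\<Sum>i=1..n. \<Sum>j=1..n. ?G i j (path \<omega>) * ?U i j \<omega>) = ?G (D n False \<omega>) (D n True \<omega>) (path \<omega>)"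
      using elim by simp
    have "(path \<omega>)(Suc n := path \<omega> (D n False \<omega>) + path \<omega> (D n True \<omega>)) = path \<omega>"
      using elim(1) by (simp add: path_def fun_eq_iff)
    thus ?case unfolding sum_eq by (simp only:)
  qed
  hence "expectation (\<lambda>\<omega>. g (path \<omega>)) = expectation (\<lambda>\<omega>. \<Sum>i=1..n. \<Sum>j=1..n. ?G i j (path \<omega>) * ?U i j \<omega>)"
    by (rule integral_cong_AE[rotated 2])
       (rule measurable_path_depends[OF g],
        intro borel_measurable_sum borel_measurable_integrable int)
  also have "\<dots> = (\<Sum>i=1..n. expectation (\<lambda>\<omega>. \<Sum>j=1..n. ?G i j (path \<omega>) * ?U i j \<omega>))"
    by (rule Bochner_Integration.integral_sum) (intro Bochner_Integration.integrable_sum int)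
  also have "\<dots> = (\<Sum>i=1..n. \<Sum>j=1..n. expectation (\<lambda>\<omega>. ?G i j (path \<omega>) * ?U i j \<omega>))"
    by (intro sum.cong refl Bochner_Integration.integral_sum int)
  also have "\<dots> = (\<Sum>i=1..n. \<Sum>j=1..n. expectation (\<lambda>\<omega>. ?G i j (path \<omega>)) / (real n)\<^sup>2)"
    by (intro sum.cong refl expectation_history_draw[OF n G] integrable_path_depends[OF G])
  also have "\<dots> = (\<Sum>i=1..n. \<Sum>j=1..n. expectation (\<lambda>\<omega>. ?G i j (path \<omega>))) / (real n)\<^sup>2"
    by (simp only: sum_divide_distrib)
  also have "(\<Sum>i=1..n. \<Sum>j=1..n. expectation (\<lambda>\<omega>. ?G i j (path \<omega>)))
      = (\<Sum>i=1..n. expectation (\<lambda>\<omega>. \<Sum>j=1..n. ?G i j (path \<omega>)))"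
    by (intro sum.cong refl Bochner_Integration.integral_sum[symmetric] integrable_path_depends[OF G])
  also have "\<dots> = expectation (\<lambda>\<omega>. \<Sum>i=1..n. \<Sum>j=1..n. ?G i j (path \<omega>))"
    by (rule Bochner_Integration.integral_sum[symmetric])
       (intro Bochner_Integration.integrable_sum integrable_path_depends[OF G])
  finally show ?thesis by simp
qed

lemma expectation_next_label:
  assumes n: "\<tau>\<^sub>0 \<le> n" and h: "depends_on n h"
  shows "expectation (\<lambda>\<omega>. h (path \<omega>) * f (path \<omega> (Suc n))) =
    expectation (\<lambda>\<omega>. h (path \<omega>) * pair_mean f n (path \<omega>))"
proof -
  have "depends_on (Suc n) (\<lambda>x. h x * f (x (Suc n)))"
    by (intro depends_on_times depends_on_mono[OF h] depends_on_next_label) auto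
  from expectation_step[OF n this] have "expectation (\<lambda>\<omega>. h (path \<omega>) * f (path \<omega> (Suc n))) =
    expectation (\<lambda>\<omega>. (\<Sum>i=1..n. \<Sum>j=1..n. h ((path \<omega>)(Suc n := path \<omega> i + path \<omega> j)) *
      f (path \<omega> i + path \<omega> j)) / (real n)\<^sup>2)"
    by simp
  moreover have "h (x(Suc n := z)) = h x" for x z
    by (rule depends_onD[OF h]) auto
  ultimately show ?thesis by (simp add: pair_mean_def sum_distrib_left)
qed

lemma expectation_times_noise:
  assumes n: "\<tau>\<^sub>0 \<le> n" and h: "depends_on n h"
  shows "expectation (\<lambda>\<omega>. h (path \<omega>) * noise f n (path \<omega>)) = 0"
proof -
  have "integrable M (\<lambda>\<omega>. h (path \<omega>) * f (path \<omega> (Suc n)))"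
    by (intro integrable_path_depends[where n = "Suc n"] depends_on_times
      depends_on_mono[OF h] depends_on_next_label) auto
  moreover have "integrable M (\<lambda>\<omega>. h (path \<omega>) * pair_mean f n (path \<omega>))"
    by (intro integrable_path_depends[where n = n] depends_on_times h depends_on_pair_mean)
  ultimately show ?thesis
    by (simp add: noise_def right_diff_distrib expectation_next_label[OF n h])
qed

lemma expectation_noise_square_le:
  assumes n: "\<tau>\<^sub>0 \<le> n"
  shows "expectation (\<lambda>\<omega>. (noise f n (path \<omega>))\<^sup>2) \<le> expectation (\<lambda>\<omega>. (f (path \<omega> (Suc n)))\<^sup>2)"
proof -
  let ?p = "pair_mean f n"
  have int_f: "integrable M (\<lambda>\<omega>. (f (path \<omega> (Suc n)))\<^sup>2)"
    by (rule integrable_path_depends[where n = "Suc n"], rule depends_on_next_label)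
  have int_p: "integrable M (\<lambda>\<omega>. (?p (path \<omega>))\<^sup>2)"
    by (intro integrable_path_depends[where n = n] depends_on_square depends_on_pair_mean)
  have int_pf: "integrable M (\<lambda>\<omega>. ?p (path \<omega>) * noise f n (path \<omega>))"
    by (intro integrable_path_depends[where n = "Suc n"] depends_on_times
      depends_on_mono[OF depends_on_pair_mean] depends_on_noise) auto
  have "(noise f n x)\<^sup>2 = (f (x (Suc n)))\<^sup>2 - 2 * (?p x * noise f n x) - (?p x)\<^sup>2" for x
    by (simp add: noise_def power2_eq_square algebra_simps)
  hence "expectation (\<lambda>\<omega>. (noise f n (path \<omega>))\<^sup>2) = expectation (\<lambda>\<omega>. (f (path \<omega> (Suc n)))\<^sup>2)
      - 2 * expectation (\<lambda>\<omega>. ?p (path \<omega>) * noise f n (path \<omega>)) - expectation (\<lambda>\<omega>. (?p (path \<omega>))\<^sup>2)"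
    using int_f int_p int_pf by simp
  also have "\<dots> = expectation (\<lambda>\<omega>. (f (path \<omega> (Suc n)))\<^sup>2) - expectation (\<lambda>\<omega>. (?p (path \<omega>))\<^sup>2)"
    by (simp add: expectation_times_noise[OF n depends_on_pair_mean])
  also have "\<dots> \<le> expectation (\<lambda>\<omega>. (f (path \<omega> (Suc n)))\<^sup>2)"
    by (simp add: integral_nonneg_AE)
  finally show ?thesis .
qed

section \<open>Maximal inequality and convergence of noise sums\<close>

text \<open>
  The noise terms are orthogonal, so their variances add up.
\<close>

lemma expectation_noise_sum_square_le:
  assumes m: "\<tau>\<^sub>0 \<le> m" "m \<le> n"
    and c: "\<And>j. m \<le> j \<Longrightarrow> expectation (\<lambda>\<omega>. (f j (path \<omega> (Suc j)))\<^sup>2) \<le> c j"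
  shows "expectation (\<lambda>\<omega>. (noise_sum f m n (path \<omega>))\<^sup>2) \<le> (\<Sum>j=m..<n. c j)"
  using m(2)
proof (induction n rule: dec_induct)
  case base
  show ?case by simp
next
  case (step n)
  let ?W = "noise_sum f m n" and ?\<xi> = "noise (f n) n"
  have n: "\<tau>\<^sub>0 \<le> n" using m step by simp
  have int1: "integrable M (\<lambda>\<omega>. (?W (path \<omega>))\<^sup>2)"
    by (intro integrable_path_depends[where n = n] depends_on_square depends_on_noise_sum) auto
  have int2: "integrable M (\<lambda>\<omega>. ?W (path \<omega>) * ?\<xi> (path \<omega>))"
    by (intro integrable_path_depends[where n = "Suc n"] depends_on_times
      depends_on_noise_sum depends_on_noise) auto
  have int3: "integrable M (\<lambda>\<omega>. (?\<xi> (path \<omega>))\<^sup>2)"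
    by (intro integrable_path_depends[where n = "Suc n"] depends_on_square depends_on_noise)
  have "(noise_sum f m (Suc n) x)\<^sup>2 = (?W x)\<^sup>2 + 2 * (?W x * ?\<xi> x) + (?\<xi> x)\<^sup>2" for x
    using step.hyps by (simp add: noise_sum_Suc power2_eq_square algebra_simps)
  hence "expectation (\<lambda>\<omega>. (noise_sum f m (Suc n) (path \<omega>))\<^sup>2) = expectation (\<lambda>\<omega>. (?W (path \<omega>))\<^sup>2)
      + 2 * expectation (\<lambda>\<omega>. ?W (path \<omega>) * ?\<xi> (path \<omega>)) + expectation (\<lambda>\<omega>. (?\<xi> (path \<omega>))\<^sup>2)"
    using int1 int2 int3 by simp
  also have "expectation (\<lambda>\<omega>. ?W (path \<omega>) * ?\<xi> (path \<omega>)) = 0"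
    by (rule expectation_times_noise[OF n depends_on_noise_sum]) simp
  finally show ?case
    using step.IH expectation_noise_square_le[OF n, of "f n"] c[of n] step.hyps by simp
qed

text \<open>
  Kolmogorov's maximal inequality for the martingale of noise sums.
\<close>

lemma noise_sum_maximal_ineq:
  assumes m: "\<tau>\<^sub>0 \<le> m" "m \<le> N" and l: "l > 0"
    and c: "\<And>j. m \<le> j \<Longrightarrow> expectation (\<lambda>\<omega>. (f j (path \<omega> (Suc j)))\<^sup>2) \<le> c j"
  shows "prob {\<omega> \<in> space M. \<exists>n\<in>{m..N}. l \<le> \<bar>noise_sum f m n (path \<omega>)\<bar>} \<le> (\<Sum>j=m..<N. c j) / l\<^sup>2"
proof -
  define B where "B = (\<lambda>n x. \<forall>k\<in>{m..n}. \<bar>noise_sum f m k x\<bar> < l)"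
  define V where "V = (\<lambda>n x. if B n x then (noise_sum f m n x)\<^sup>2 else l\<^sup>2)"
  \<comment> \<open>\<open>V n\<close> is the squared noise sum, replaced by \<open>l\<^sup>2\<close> from the first exceedance of \<open>l\<close> on. Its
    expectation grows by at most the variance of the next noise term, and it dominates \<open>l\<^sup>2\<close>
    times the indicator of the exceedance event.\<close>
  have B_dep: "depends_on n (B n)" for n
    unfolding depends_on_def
  proof (intro allI impI)
    fix x y :: "nat \<Rightarrow> int" assume "\<forall>i\<in>{1..n}. x i = y i"
    hence "noise_sum f m k x = noise_sum f m k y" if "k \<le> n" for k
      by (intro depends_onD[OF depends_on_noise_sum[OF that]]) auto
    thus "B n x = B n y" by (simp add: B_def)
  qed
  have V_dep: "depends_on n (V n)" for n
    unfolding V_def using depends_on_combine[OF B_dep depends_on_noise_sum[OF order_refl],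
      where F = "\<lambda>b w. if b then w\<^sup>2 else l\<^sup>2"] by simp
  have "expectation (\<lambda>\<omega>. V n (path \<omega>)) \<le> (\<Sum>j=m..<n. c j)" if "m \<le> n" for n
    using that
  proof (induction n rule: dec_induct)
    case base
    have "V m x = 0" for x using l by (simp add: V_def B_def)
    thus ?case by simp
  next
    case (step n)
    let ?W = "noise_sum f m n" and ?\<xi> = "noise (f n) n"
    let ?H = "\<lambda>x. of_bool (B n x) * ?W x"
    have n: "\<tau>\<^sub>0 \<le> n" using m step by simp
    have H: "depends_on n ?H"
      by (intro depends_on_combine[where F = "\<lambda>b w. of_bool b * w"] B_dep depends_on_noise_sum) auto
    have int1: "integrable M (\<lambda>\<omega>. V n (path \<omega>))" and int1': "integrable M (\<lambda>\<omega>. V (Suc n) (path \<omega>))"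
      by (rule integrable_path_depends[OF V_dep])+
    have int2: "integrable M (\<lambda>\<omega>. ?H (path \<omega>) * ?\<xi> (path \<omega>))"
      by (intro integrable_path_depends[where n = "Suc n"] depends_on_times
        depends_on_mono[OF H] depends_on_noise) auto
    have int3: "integrable M (\<lambda>\<omega>. (?\<xi> (path \<omega>))\<^sup>2)"
      by (intro integrable_path_depends[where n = "Suc n"] depends_on_square depends_on_noise)
    have "V (Suc n) x \<le> V n x + 2 * (?H x * ?\<xi> x) + (?\<xi> x)\<^sup>2" for x
    proof (cases "B n x")
      case True
      have "V (Suc n) x \<le> (noise_sum f m (Suc n) x)\<^sup>2"
      proof (cases "B (Suc n) x")
        case False
        with True have "l \<le> \<bar>noise_sum f m (Suc n) x\<bar>"
          by (force simp: B_def le_Suc_eq)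
        thus ?thesis using False l by (simp add: V_def abs_le_square_iff[symmetric])
      qed (simp add: V_def)
      also have "\<dots> = (?W x)\<^sup>2 + 2 * (?W x * ?\<xi> x) + (?\<xi> x)\<^sup>2"
        using step.hyps by (simp add: noise_sum_Suc power2_eq_square algebra_simps)
      finally show ?thesis using True by (simp add: V_def)
    next
      case False
      hence "\<not> B (Suc n) x" by (auto simp: B_def)
      thus ?thesis using False by (simp add: V_def)
    qed
    hence "expectation (\<lambda>\<omega>. V (Suc n) (path \<omega>)) \<le>
      expectation (\<lambda>\<omega>. V n (path \<omega>) + 2 * (?H (path \<omega>) * ?\<xi> (path \<omega>)) + (?\<xi> (path \<omega>))\<^sup>2)"
      using int1 int1' int2 int3 by (intro integral_mono) auto
    also have "\<dots> = expectation (\<lambda>\<omega>. V n (path \<omega>))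
        + 2 * expectation (\<lambda>\<omega>. ?H (path \<omega>) * ?\<xi> (path \<omega>)) + expectation (\<lambda>\<omega>. (?\<xi> (path \<omega>))\<^sup>2)"
      using int1 int2 int3 by simp
    also have "expectation (\<lambda>\<omega>. ?H (path \<omega>) * ?\<xi> (path \<omega>)) = 0"
      by (rule expectation_times_noise[OF n H])
    finally show ?case
      using step.IH expectation_noise_square_le[OF n, of "f n"] c[of n] step.hyps by simp
  qed
  note V_le = this[OF m(2)]
  have meas: "{\<omega> \<in> space M. \<not> B N (path \<omega>)} \<in> sets M"
  proof -
    have "depends_on N (\<lambda>x. of_bool (B N x) :: real)" by (intro depends_on_combine[where F = "\<lambda>b _. of_bool b", OF B_dep B_dep])
    from measurable_path_depends[OF this]
    have "{\<omega> \<in> space M. of_bool (B N (path \<omega>)) = (0::real)} \<in> sets M" by measurable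
    thus ?thesis by simp
  qed
  have "prob {\<omega> \<in> space M. \<not> B N (path \<omega>)} * l\<^sup>2
      = expectation (\<lambda>\<omega>. indicator {\<omega> \<in> space M. \<not> B N (path \<omega>)} \<omega> * l\<^sup>2)"
    using meas by simp
  also have "\<dots> \<le> expectation (\<lambda>\<omega>. V N (path \<omega>))"
    using meas integrable_path_depends[OF V_dep, of N]
    by (intro integral_mono integrable_mult_left integrable_real_indicator)
       (auto simp: V_def indicator_def less_top[symmetric])
  also have "\<dots> \<le> (\<Sum>j=m..<N. c j)" by (rule V_le)
  finally show ?thesis using l
    by (simp add: B_def not_less pos_le_divide_eq)
qed

lemma noise_sum_maximal_event [measurable]:
  "{\<omega> \<in> space M. \<exists>n\<in>{m..N}. l \<le> \<bar>noise_sum f m n (path \<omega>)\<bar>} \<in> sets M"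
proof -
  have [measurable]: "(\<lambda>\<omega>. noise_sum f m n (path \<omega>)) \<in> borel_measurable M" for n
    by (rule measurable_path_depends[OF depends_on_noise_sum[OF order_refl]])
  show ?thesis by measurable
qed

lemma noise_sum_maximal_ineq_infinite:
  assumes m: "\<tau>\<^sub>0 \<le> m" and l: "l > 0"
    and c: "\<And>j. m \<le> j \<Longrightarrow> expectation (\<lambda>\<omega>. (f j (path \<omega> (Suc j)))\<^sup>2) \<le> c j"
    and C: "\<And>N. (\<Sum>j=m..<N. c j) \<le> C"
  shows "prob {\<omega> \<in> space M. \<exists>n\<ge>m. l \<le> \<bar>noise_sum f m n (path \<omega>)\<bar>} \<le> C / l\<^sup>2"
    and "{\<omega> \<in> space M. \<exists>n\<ge>m. l \<le> \<bar>noise_sum f m n (path \<omega>)\<bar>} \<in> sets M"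
proof -
  let ?A = "\<lambda>N. {\<omega> \<in> space M. \<exists>n\<in>{m..N}. l \<le> \<bar>noise_sum f m n (path \<omega>)\<bar>}"
  have U: "(\<Union>N. ?A N) = {\<omega> \<in> space M. \<exists>n\<ge>m. l \<le> \<bar>noise_sum f m n (path \<omega>)\<bar>}"
    by (fastforce simp del: atLeastAtMost_iff simp: atLeastAtMost_def)
  have "(\<lambda>N. prob (?A N)) \<longlonglongrightarrow> prob (\<Union>N. ?A N)"
    by (rule finite_Lim_measure_incseq) (auto simp: incseq_def intro: order_trans)
  moreover have "\<exists>N0. \<forall>N\<ge>N0. prob (?A N) \<le> C / l\<^sup>2"
  proof (intro exI[of _ m] allI impI)
    fix N assume "m \<le> N"
    have "prob (?A N) \<le> (\<Sum>j=m..<N. c j) / l\<^sup>2"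
      by (rule noise_sum_maximal_ineq[OF m \<open>m \<le> N\<close> l c])
    also have "\<dots> \<le> C / l\<^sup>2" using C[of N] l by (simp add: divide_right_mono)
    finally show "prob (?A N) \<le> C / l\<^sup>2" .
  qed
  ultimately have "prob (\<Union>N. ?A N) \<le> C / l\<^sup>2" by (rule LIMSEQ_le_const2)
  thus "prob {\<omega> \<in> space M. \<exists>n\<ge>m. l \<le> \<bar>noise_sum f m n (path \<omega>)\<bar>} \<le> C / l\<^sup>2"
    unfolding U .
  have "(\<Union>N. ?A N) \<in> sets M" by auto
  thus "{\<omega> \<in> space M. \<exists>n\<ge>m. l \<le> \<bar>noise_sum f m n (path \<omega>)\<bar>} \<in> sets M"
    unfolding U .
qed

text \<open>
  The Borel--Cantelli lemma in the form in which it is applied below; the offset \<open>d\<close> lets the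
  events start at the initial time.
\<close>

lemma AE_eventually_not:
  assumes "\<And>k. A k \<in> sets M" and "\<And>k. prob (A k) \<le> C / (real (k + d))\<^sup>2"
  shows "AE \<omega> in M. \<forall>\<^sub>F k in sequentially. \<omega> \<notin> A k"
proof -
  have "summable (\<lambda>k. 1 / (real k)\<^sup>2)"
    using inverse_power_summable[of 2, where 'a = real] by (simp add: inverse_eq_divide)
  hence "summable (\<lambda>k. C * (1 / (real (k + d))\<^sup>2))"
    by (intro summable_mult summable_ignore_initial_segment[where f = "\<lambda>k. 1 / (real k)\<^sup>2"])
  hence "summable (\<lambda>k. prob (A k))"
    by (rule summable_comparison_test[rotated]) (use assms(2) in auto)
  from borel_cantelli_AE1[OF assms(1) _ this]
  have "AE \<omega> in M. \<forall>\<^sub>F k in sequentially. \<omega> \<in> space M - A k" by (simp add: less_top[symmetric])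
  thus ?thesis by eventually_elim (auto elim: eventually_mono)
qed

lemma AE_noise_sum_convergent:
  assumes c: "\<And>j. \<tau>\<^sub>0 \<le> j \<Longrightarrow> expectation (\<lambda>\<omega>. (f j (path \<omega> (Suc j)))\<^sup>2) \<le> c j"
    and C: "\<And>m N. \<tau>\<^sub>0 \<le> m \<Longrightarrow> (\<Sum>j=m..<N. c j) \<le> C / real m"
  shows "AE \<omega> in M. convergent (\<lambda>n. noise_sum f \<tau>\<^sub>0 n (path \<omega>))"
proof -
  define m where "m = (\<lambda>k. (k + \<tau>\<^sub>0) ^ 4)"
  define A where "A = (\<lambda>k. {\<omega> \<in> space M. \<exists>n\<ge>m k. 1 / real (k + \<tau>\<^sub>0) \<le> \<bar>noise_sum f (m k) n (path \<omega>)\<bar>})"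
  \<comment> \<open>With \<open>r = k + \<tau>\<^sub>0\<close>, a fluctuation of size \<open>1 / r\<close> after time \<open>r ^ 4\<close> has
    probability at most \<open>C / r ^ 4 * r\<^sup>2\<close>, which is summable.\<close>
  have pos: "0 < k + \<tau>\<^sub>0" for k using initial_size by simp
  have m: "\<tau>\<^sub>0 \<le> m k" for k
  proof -
    have "\<tau>\<^sub>0 \<le> (k + \<tau>\<^sub>0) ^ 1" by simp
    also have "\<dots> \<le> m k" unfolding m_def using pos[of k] by (intro power_increasing) auto
    finally show ?thesis .
  qed
  have l: "0 < 1 / real (k + \<tau>\<^sub>0)" for k using pos[of k] by (simp del: of_nat_add)
  note maximal = noise_sum_maximal_ineq_infinite[OF m l c[OF order_trans[OF m]] C[OF m]]
  have sets: "A k \<in> sets M" for k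
    unfolding A_def by (rule maximal(2))
  have "prob (A k) \<le> C / (real (k + \<tau>\<^sub>0))\<^sup>2" for k
  proof -
    have "prob (A k) \<le> C / real (m k) / (1 / real (k + \<tau>\<^sub>0))\<^sup>2"
      unfolding A_def by (rule maximal(1))
    also have "\<dots> = C / (real (k + \<tau>\<^sub>0))\<^sup>2"
      using pos[of k] by (simp add: m_def divide_simps flip: of_nat_add)
    finally show ?thesis .
  qed
  from AE_eventually_not[OF sets this] AE_space show ?thesis
  proof eventually_elim
    case (elim \<omega>)
    let ?W = "\<lambda>m n. noise_sum f m n (path \<omega>)"
    have "Cauchy (?W \<tau>\<^sub>0)"
    proof (rule CauchyI')
      fix e :: real assume e: "e > 0"
      obtain K where K: "\<And>k. k \<ge> K \<Longrightarrow> \<omega> \<notin> A k"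
        using elim(1) by (auto simp: eventually_sequentially)
      obtain k0 :: nat where k0: "2 / e < real k0" using reals_Archimedean2 by blast
      define k where "k = K + k0"
      have "2 / e < real (k + \<tau>\<^sub>0)" using k0 by (simp add: k_def)
      moreover have "0 < real (k + \<tau>\<^sub>0)" using pos[of k] by (simp only: of_nat_0_less_iff)
      ultimately have k2: "2 / real (k + \<tau>\<^sub>0) < e" using e
        by (simp only: pos_divide_less_eq mult.commute)
      have W: "\<bar>?W (m k) n\<bar> < 1 / real (k + \<tau>\<^sub>0)" if "m k \<le> n" for n
      proof (rule ccontr)
        assume "\<not> ?thesis"
        hence "\<omega> \<in> A k" using that elim(2) unfolding A_def by (auto simp only: not_less)
        thus False using K[of k] by (simp add: k_def)
      qed
      have split: "?W \<tau>\<^sub>0 n = ?W \<tau>\<^sub>0 (m k) + ?W (m k) n" if "m k \<le> n" for n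
        unfolding noise_sum_def using m[of k] that by (simp add: sum.atLeastLessThan_concat)
      show "\<exists>M0. \<forall>p\<ge>M0. \<forall>n>p. dist (?W \<tau>\<^sub>0 p) (?W \<tau>\<^sub>0 n) < e"
      proof (intro exI[of _ "m k"] allI impI)
        fix p n assume "m k \<le> p" "p < n"
        thus "dist (?W \<tau>\<^sub>0 p) (?W \<tau>\<^sub>0 n) < e"
          using split[of p] split[of n] W[of p] W[of n] k2 unfolding dist_real_def by linarith
      qed
    qed
    thus ?case by (rule Cauchy_convergent)
  qed
qed

section \<open>Moment growth\<close>

lemma expectation_next_square:
  assumes n: "\<tau>\<^sub>0 \<le> n"
  shows "expectation (\<lambda>\<omega>. (real_of_int (path \<omega> (Suc n)))\<^sup>2) =
    2 / n * expectation (\<lambda>\<omega>. square_sum n (path \<omega>)) + 2 / (real n)\<^sup>2 * expectation (\<lambda>\<omega>. (label_sum n (path \<omega>))\<^sup>2)"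
proof -
  have "n \<ge> 1" using n initial_size by simp
  have "depends_on n (\<lambda>_. 1 :: real)" by (simp add: depends_on_def)
  from expectation_next_label[OF n this, of "\<lambda>z. (real_of_int z)\<^sup>2"]
  have "expectation (\<lambda>\<omega>. (real_of_int (path \<omega> (Suc n)))\<^sup>2) =
    expectation (\<lambda>\<omega>. 2 / n * square_sum n (path \<omega>) + 2 / (real n)\<^sup>2 * (label_sum n (path \<omega>))\<^sup>2)"
    by (simp add: pair_mean_square[OF \<open>n \<ge> 1\<close>])
  thus ?thesis
    using integrable_path_depends[OF depends_on_square_sum, of n]
      integrable_path_depends[OF depends_on_square[OF depends_on_label_sum], of n] by simp
qed

lemma expectation_square_sum_Suc:
  assumes n: "\<tau>\<^sub>0 \<le> n"
  shows "expectation (\<lambda>\<omega>. square_sum (Suc n) (path \<omega>)) =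
    expectation (\<lambda>\<omega>. square_sum n (path \<omega>)) + expectation (\<lambda>\<omega>. (real_of_int (path \<omega> (Suc n)))\<^sup>2)"
  using integrable_path_depends[OF depends_on_square_sum, of n]
    integrable_path_depends[OF depends_on_next_label, of "\<lambda>z. (real_of_int z)\<^sup>2" n]
  by (simp add: square_sum_Suc)

lemma expectation_label_sum_square_Suc:
  assumes n: "\<tau>\<^sub>0 \<le> n"
  shows "expectation (\<lambda>\<omega>. (label_sum (Suc n) (path \<omega>))\<^sup>2) =
    (1 + 4 / n) * expectation (\<lambda>\<omega>. (label_sum n (path \<omega>))\<^sup>2)
    + expectation (\<lambda>\<omega>. (real_of_int (path \<omega> (Suc n)))\<^sup>2)"
proof -
  have sq: "(label_sum (Suc n) x)\<^sup>2 = (label_sum n x)\<^sup>2 + 2 * (label_sum n x * x (Suc n)) + (real_of_int (x (Suc n)))\<^sup>2" for x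
    by (simp add: label_sum_Suc power2_eq_square algebra_simps)
  have mixed: "expectation (\<lambda>\<omega>. label_sum n (path \<omega>) * real_of_int (path \<omega> (Suc n)))
     = 2 / n * expectation (\<lambda>\<omega>. (label_sum n (path \<omega>))\<^sup>2)"
  proof -
    have "expectation (\<lambda>\<omega>. label_sum n (path \<omega>) * real_of_int (path \<omega> (Suc n)))
      = expectation (\<lambda>\<omega>. label_sum n (path \<omega>) * (2 * label_sum n (path \<omega>) / n))"
      using expectation_next_label[OF n depends_on_label_sum, of "\<lambda>z. real_of_int z"]
      by (simp only: pair_mean_label)
    also have "\<dots> = expectation (\<lambda>\<omega>. 2 / n * (label_sum n (path \<omega>))\<^sup>2)"
      by (intro Bochner_Integration.integral_cong) (auto simp: power2_eq_square)
    finally show ?thesis by simp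
  qed
  have int: "integrable M (\<lambda>\<omega>. (label_sum n (path \<omega>))\<^sup>2)"
    by (rule integrable_path_depends[OF depends_on_square[OF depends_on_label_sum]])
  have int': "integrable M (\<lambda>\<omega>. label_sum n (path \<omega>) * real_of_int (path \<omega> (Suc n)))"
    by (rule integrable_path_depends[OF depends_on_times[OF depends_on_mono[OF depends_on_label_sum] depends_on_next_label]]) simp
  have int'': "integrable M (\<lambda>\<omega>. (real_of_int (path \<omega> (Suc n)))\<^sup>2)"
    by (rule integrable_path_depends[OF depends_on_next_label])
  show ?thesis unfolding sq using int int' int'' mixed by (simp add: algebra_simps)
qed

text \<open>
  The second moments of the label sum and the mean of the square sum satisfy a closed linear
  recursion, whose solutions have order \<open>n ^ 4\<close> and \<open>n ^ 3\<close>.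
\<close>

lemma moment_growth:
  obtains K where "K > 0"
    "\<And>n. \<tau>\<^sub>0 \<le> n \<Longrightarrow> expectation (\<lambda>\<omega>. square_sum n (path \<omega>)) \<le> K * real n ^ 3"
    "\<And>n. \<tau>\<^sub>0 \<le> n \<Longrightarrow> expectation (\<lambda>\<omega>. (real_of_int (path \<omega> (Suc n)))\<^sup>2) \<le> K * (real n + 1)\<^sup>2"
proof -
  define s where "s = (\<lambda>n. expectation (\<lambda>\<omega>. (label_sum n (path \<omega>))\<^sup>2))"
  define q where "q = (\<lambda>n. expectation (\<lambda>\<omega>. square_sum n (path \<omega>)))"
  define e where "e = (\<lambda>n. expectation (\<lambda>\<omega>. (real_of_int (path \<omega> (Suc n)))\<^sup>2))"
  have e: "e n = 2 / n * q n + 2 / (real n)\<^sup>2 * s n" if "\<tau>\<^sub>0 \<le> n" for n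
    using expectation_next_square[OF that] by (simp add: e_def q_def s_def)
  have q_Suc: "q (Suc n) = q n + e n" if "\<tau>\<^sub>0 \<le> n" for n
    using expectation_square_sum_Suc[OF that] by (simp add: e_def q_def)
  have s_Suc: "s (Suc n) = (1 + 4 / n) * s n + e n" if "\<tau>\<^sub>0 \<le> n" for n
    using expectation_label_sum_square_Suc[OF that] by (simp add: e_def s_def)
  have nonneg: "q n \<ge> 0" "s n \<ge> 0" for n
    by (auto simp: q_def s_def square_sum_def intro!: Bochner_Integration.integral_nonneg sum_nonneg)
  define K where "K = (\<tau>\<^sub>0 + 8) * (s \<tau>\<^sub>0 + q \<tau>\<^sub>0 + 1)"
  have K: "K \<ge> 0" using nonneg[of \<tau>\<^sub>0] by (simp add: K_def)
  \<comment> \<open>The exact recursion exceeds the growth \<open>n ^ 4\<close> by factors \<open>1 + O(1 / n\<^sup>2)\<close>; the weight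
    \<open>n / (n + 8)\<close> increases fast enough to absorb their product.\<close>
  have main: "(n + 8) * s n \<le> K * real n ^ 3 * (real n + 1)\<^sup>2 \<and> (n + 8) * q n \<le> 2 * K * real n ^ 3 * (real n + 1)"
    if "\<tau>\<^sub>0 \<le> n" for n
    using that
  proof (induction n rule: dec_induct)
    case base
    have t: "1 \<le> real \<tau>\<^sub>0 ^ 3" using initial_size by simp
    have "(\<tau>\<^sub>0 + 8) * s \<tau>\<^sub>0 \<le> K" "(\<tau>\<^sub>0 + 8) * q \<tau>\<^sub>0 \<le> K"
      unfolding K_def using nonneg[of \<tau>\<^sub>0] by (intro mult_left_mono; simp)+
    moreover have "K * 1 \<le> K * (real \<tau>\<^sub>0 ^ 3 * (real \<tau>\<^sub>0 + 1)\<^sup>2)" "K * 1 \<le> K * (2 * real \<tau>\<^sub>0 ^ 3 * (real \<tau>\<^sub>0 + 1))"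
    proof -
      have "1 * 1 \<le> real \<tau>\<^sub>0 ^ 3 * (real \<tau>\<^sub>0 + 1)\<^sup>2" using t by (intro mult_mono) auto
      thus "K * 1 \<le> K * (real \<tau>\<^sub>0 ^ 3 * (real \<tau>\<^sub>0 + 1)\<^sup>2)" using K by (intro mult_left_mono) auto
      have "1 * 1 \<le> (2 * real \<tau>\<^sub>0 ^ 3) * (real \<tau>\<^sub>0 + 1)" using t by (intro mult_mono) auto
      thus "K * 1 \<le> K * (2 * real \<tau>\<^sub>0 ^ 3 * (real \<tau>\<^sub>0 + 1))" using K by (intro mult_left_mono) auto
    qed
    ultimately show ?case by (simp add: mult_ac)
  next
    case (step n)
    define r where "r = real n"
    have r: "r \<ge> 1" using step.hyps initial_size by (simp add: r_def)
    have IHs: "(r + 8) * s n \<le> K * r ^ 3 * (r + 1)\<^sup>2" and IHq: "(r + 8) * q n \<le> 2 * K * r ^ 3 * (r + 1)"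
      using step.IH by (simp_all add: r_def add_ac)
    have en: "r\<^sup>2 * e n = 2 * r * q n + 2 * s n"
      using r by (simp add: e[OF step.hyps(1)] r_def[symmetric] power2_eq_square field_simps)
    have e_bound: "(r + 8) * (r\<^sup>2 * e n) \<le> r\<^sup>2 * (K * (4 * r\<^sup>2 * (r + 1) + 2 * r * (r + 1)\<^sup>2))"
    proof -
      have "(r + 8) * (r\<^sup>2 * e n) = 2 * r * ((r + 8) * q n) + 2 * ((r + 8) * s n)"
        unfolding en by (simp add: algebra_simps)
      also have "\<dots> \<le> 2 * r * (2 * K * r ^ 3 * (r + 1)) + 2 * (K * r ^ 3 * (r + 1)\<^sup>2)"
        using r by (intro add_mono mult_left_mono IHs IHq) auto
      also have "\<dots> = r\<^sup>2 * (K * (4 * r\<^sup>2 * (r + 1) + 2 * r * (r + 1)\<^sup>2))"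
        by (simp add: power2_eq_square power3_eq_cube algebra_simps)
      finally show ?thesis .
    qed
    have e_bound': "(r + 8) * e n \<le> K * (4 * r\<^sup>2 * (r + 1) + 2 * r * (r + 1)\<^sup>2)"
    proof -
      have "r\<^sup>2 * ((r + 8) * e n) \<le> r\<^sup>2 * (K * (4 * r\<^sup>2 * (r + 1) + 2 * r * (r + 1)\<^sup>2))"
        using e_bound by (simp add: mult_ac)
      moreover have "r\<^sup>2 > 0" using r by simp
      ultimately show ?thesis by (simp only: mult_le_cancel_left_pos)
    qed
    have s': "(r + 8) * s (Suc n) \<le> K * (r * (r + 1) * ((r + 4) * r * (r + 1) + 4 * r + 2 * (r + 1)))"
    proof -
      have "(1 + 4 / r) * ((r + 8) * s n) \<le> (1 + 4 / r) * (K * r ^ 3 * (r + 1)\<^sup>2)"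
        using r by (intro mult_left_mono IHs) auto
      also have "\<dots> = K * ((r + 4) * r\<^sup>2 * (r + 1)\<^sup>2)"
        using r by (simp add: field_simps power2_eq_square power3_eq_cube)
      finally have "(r + 8) * s (Suc n) \<le> K * ((r + 4) * r\<^sup>2 * (r + 1)\<^sup>2) + K * (4 * r\<^sup>2 * (r + 1) + 2 * r * (r + 1)\<^sup>2)"
      proof -
        assume "(1 + 4 / r) * ((r + 8) * s n) \<le> K * ((r + 4) * r\<^sup>2 * (r + 1)\<^sup>2)"
        moreover have "(r + 8) * s (Suc n) = (1 + 4 / r) * ((r + 8) * s n) + (r + 8) * e n"
          by (simp only: s_Suc[OF step.hyps(1)] r_def[symmetric] distrib_left mult.left_commute)
        ultimately show ?thesis using e_bound' by linarith
      qed
      thus ?thesis by (simp add: power2_eq_square algebra_simps)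
    qed
    have "(r + 8) * ((r + 9) * s (Suc n)) \<le> (r + 9) * (K * (r * (r + 1) * ((r + 4) * r * (r + 1) + 4 * r + 2 * (r + 1))))"
      using mult_left_mono[OF s', of "r + 9"] r by (simp add: mult_ac)
    also have "\<dots> \<le> (r + 8) * (K * (r + 1) ^ 3 * (r + 2)\<^sup>2)"
    proof -
      have "0 \<le> 6 * r ^ 3 + 24 * r ^ 2 + 82 * r + 32" using r by (intro add_nonneg_nonneg) auto
      hence "(r + 9) * (r * ((r + 4) * r * (r + 1) + 4 * r + 2 * (r + 1))) \<le> (r + 8) * ((r + 1)\<^sup>2 * (r + 2)\<^sup>2)"
        by (simp add: power2_eq_square power3_eq_cube algebra_simps)
      hence "(K * (r + 1)) * ((r + 9) * (r * ((r + 4) * r * (r + 1) + 4 * r + 2 * (r + 1)))) \<le> (K * (r + 1)) * ((r + 8) * ((r + 1)\<^sup>2 * (r + 2)\<^sup>2))"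
        using K r by (intro mult_left_mono) auto
      thus ?thesis by (simp add: power2_eq_square power3_eq_cube mult_ac)
    qed
    finally have 1: "(r + 9) * s (Suc n) \<le> K * (r + 1) ^ 3 * (r + 2)\<^sup>2" using r by simp
    have q': "(r + 8) * q (Suc n) \<le> K * (2 * r * (r + 1) * (r\<^sup>2 + 3 * r + 1))"
      using IHq e_bound' by (simp add: q_Suc[OF step.hyps(1)] power2_eq_square power3_eq_cube algebra_simps)
    have "(r + 8) * ((r + 9) * q (Suc n)) \<le> (r + 9) * (K * (2 * r * (r + 1) * (r\<^sup>2 + 3 * r + 1)))"
      using mult_left_mono[OF q', of "r + 9"] r by (simp add: mult_ac)
    also have "\<dots> \<le> (r + 8) * (2 * K * (r + 1) ^ 3 * (r + 2))"
    proof -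
      have "(r + 9) * r * (r\<^sup>2 + 3 * r + 1) \<le> (r + 8) * (r + 1) * ((r + 1) * (r + 2))"
        using r by - (rule mult_mono, auto simp: power2_eq_square algebra_simps)
      hence "(2 * K * (r + 1)) * ((r + 9) * r * (r\<^sup>2 + 3 * r + 1)) \<le> (2 * K * (r + 1)) * ((r + 8) * (r + 1) * ((r + 1) * (r + 2)))"
        using K r by (intro mult_left_mono) auto
      thus ?thesis by (simp add: power2_eq_square power3_eq_cube mult_ac)
    qed
    finally have 2: "(r + 9) * q (Suc n) \<le> 2 * K * (r + 1) ^ 3 * (r + 2)" using r by simp
    show ?case using 1 2 by (simp add: r_def add_ac)
  qed
  have s: "s n \<le> K * (real n)\<^sup>2 * (real n + 1)\<^sup>2" and q: "q n \<le> 2 * K * (real n)\<^sup>2 * (real n + 1)" if "\<tau>\<^sub>0 \<le> n" for n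
  proof -
    have n: "real n \<ge> 1" using that initial_size by simp
    have "n * s n \<le> (n + 8) * s n" "n * q n \<le> (n + 8) * q n"
      using nonneg by (auto intro!: mult_right_mono)
    hence "n * s n \<le> n * (K * (real n)\<^sup>2 * (real n + 1)\<^sup>2)" "n * q n \<le> n * (2 * K * (real n)\<^sup>2 * (real n + 1))"
      using main[OF that] by (simp_all add: power2_eq_square power3_eq_cube mult_ac)
    thus "s n \<le> K * (real n)\<^sup>2 * (real n + 1)\<^sup>2" "q n \<le> 2 * K * (real n)\<^sup>2 * (real n + 1)"
      using n by auto
  qed
  show thesis
  proof (rule that[of "6 * K + 1"])
    show "6 * K + 1 > 0" using K by simp
  next
    fix n assume n: "\<tau>\<^sub>0 \<le> n"
    hence n1: "real n \<ge> 1" using initial_size by simp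
    have "q n \<le> 2 * K * (real n)\<^sup>2 * (real n + 1)" by (rule q[OF n])
    also have "\<dots> \<le> 2 * K * (real n)\<^sup>2 * (2 * real n)" using n1 K by (intro mult_left_mono) auto
    also have "\<dots> = 4 * K * real n ^ 3" by (simp add: power2_eq_square power3_eq_cube)
    also have "\<dots> \<le> (6 * K + 1) * real n ^ 3" using K n1 by (intro mult_right_mono) auto
    finally show "expectation (\<lambda>\<omega>. square_sum n (path \<omega>)) \<le> (6 * K + 1) * real n ^ 3" by (simp add: q_def)
    have "e n \<le> 2 / n * (2 * K * (real n)\<^sup>2 * (real n + 1)) + 2 / (real n)\<^sup>2 * (K * (real n)\<^sup>2 * (real n + 1)\<^sup>2)"
      unfolding e[OF n] by (intro add_mono mult_left_mono s[OF n] q[OF n]) auto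
    also have "\<dots> = (4 * K) * (real n * (real n + 1)) + 2 * K * (real n + 1)\<^sup>2"
      using n1 by (simp add: power2_eq_square)
    also have "\<dots> \<le> (4 * K) * ((real n + 1) * (real n + 1)) + 2 * K * (real n + 1)\<^sup>2"
      using K by (intro add_mono mult_left_mono mult_right_mono) auto
    also have "\<dots> \<le> (6 * K + 1) * (real n + 1)\<^sup>2" by (simp add: power2_eq_square algebra_simps)
    finally show "expectation (\<lambda>\<omega>. (real_of_int (path \<omega> (Suc n)))\<^sup>2) \<le> (6 * K + 1) * (real n + 1)\<^sup>2"
      by (simp add: e_def)
  qed
qed

text \<open>
  Covers both the martingale itself and its analogue for absolute values of labels.
\<close>

lemma weighted_label_noise_bounds:
  fixes f :: "nat \<Rightarrow> int \<Rightarrow> real"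
  assumes f: "\<And>j z. \<bar>f j z\<bar> = \<bar>real_of_int z\<bar> / ((real j + 1) * (real j + 2))"
  obtains K where "K > 0"
    "\<And>j. \<tau>\<^sub>0 \<le> j \<Longrightarrow> expectation (\<lambda>\<omega>. (f j (path \<omega> (Suc j)))\<^sup>2) \<le> K / (real j + 2)\<^sup>2"
    "\<And>m N. \<tau>\<^sub>0 \<le> m \<Longrightarrow> (\<Sum>j=m..<N. K / (real j + 2)\<^sup>2) \<le> K / real m"
proof -
  obtain K where K: "K > 0"
    "\<And>n. \<tau>\<^sub>0 \<le> n \<Longrightarrow> expectation (\<lambda>\<omega>. (real_of_int (path \<omega> (Suc n)))\<^sup>2) \<le> K * (real n + 1)\<^sup>2"
    using moment_growth by metis
  show thesis
  proof (rule that[OF K(1)])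
    fix j assume j: "\<tau>\<^sub>0 \<le> j"
    have "(f j z)\<^sup>2 = (real_of_int z)\<^sup>2 / ((real j + 1) * (real j + 2))\<^sup>2" for z
      using f[of j z] by (metis power2_abs power_divide)
    hence "expectation (\<lambda>\<omega>. (f j (path \<omega> (Suc j)))\<^sup>2)
       = expectation (\<lambda>\<omega>. (real_of_int (path \<omega> (Suc j)))\<^sup>2) / ((real j + 1) * (real j + 2))\<^sup>2"
      by simp
    also have "\<dots> \<le> K * (real j + 1)\<^sup>2 / ((real j + 1) * (real j + 2))\<^sup>2"
      by (intro divide_right_mono K(2)[OF j]) auto
    also have "\<dots> = K / (real j + 2)\<^sup>2" by (simp add: power_mult_distrib)
    finally show "expectation (\<lambda>\<omega>. (f j (path \<omega> (Suc j)))\<^sup>2) \<le> K / (real j + 2)\<^sup>2" .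
  next
    fix m N assume m: "\<tau>\<^sub>0 \<le> m"
    have "K / (real j + 2)\<^sup>2 \<le> K / real (j + 1) - K / real (Suc j + 1)" for j
    proof -
      have "K / (real j + 2)\<^sup>2 \<le> K / ((real j + 1) * (real j + 2))"
        using K(1) by (intro divide_left_mono) (auto simp: power2_eq_square intro!: mult_right_mono)
      also have "\<dots> = K / real (j + 1) - K / real (Suc j + 1)"
        by (simp add: divide_simps) (simp add: algebra_simps)
      finally show ?thesis .
    qed
    hence "(\<Sum>j=m..<N. K / (real j + 2)\<^sup>2) \<le> (\<Sum>j=m..<N. K / real (j + 1) - K / real (Suc j + 1))"
      by (intro sum_mono)
    also have "\<dots> \<le> K / real m"
    proof (cases "m \<le> N")
      case True
      have "(\<Sum>j=m..<N. K / real (j + 1) - K / real (Suc j + 1)) = K / real (m + 1) - K / real (N + 1)"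
        using sum_Suc_diff'[OF True, of "\<lambda>j. - (K / real (j + 1))"] by simp
      also have "\<dots> \<le> K / real (m + 1)" using K(1) by simp
      also have "\<dots> \<le> K / real m" using K(1) m initial_size by (intro divide_left_mono) auto
      finally show ?thesis .
    qed (use K(1) in simp)
    finally show "(\<Sum>j=m..<N. K / (real j + 2)\<^sup>2) \<le> K / real m" .
  qed
qed

section \<open>Almost sure behaviour of the urn\<close>

lemma AE_slope_convergent: "AE \<omega> in M. convergent (\<lambda>n. slope n (path \<omega>))"
proof -
  have "\<bar>slope_noise j z\<bar> = \<bar>real_of_int z\<bar> / ((real j + 1) * (real j + 2))" for j z
    by (simp add: slope_noise_def abs_mult)
  from weighted_label_noise_bounds[OF this] obtain K where K: "K > 0"
    "\<And>j. \<tau>\<^sub>0 \<le> j \<Longrightarrow> expectation (\<lambda>\<omega>. (slope_noise j (path \<omega> (Suc j)))\<^sup>2) \<le> K / (real j + 2)\<^sup>2"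
    "\<And>m N. \<tau>\<^sub>0 \<le> m \<Longrightarrow> (\<Sum>j=m..<N. K / (real j + 2)\<^sup>2) \<le> K / real m" by blast
  have "AE \<omega> in M. convergent (\<lambda>n. noise_sum slope_noise \<tau>\<^sub>0 n (path \<omega>))"
    by (rule AE_noise_sum_convergent[where c = "\<lambda>j. K / (real j + 2)\<^sup>2"]) (fact K(2), fact K(3))
  thus ?thesis
  proof eventually_elim
    case (elim \<omega>)
    hence "convergent (\<lambda>n. slope \<tau>\<^sub>0 (path \<omega>) + noise_sum slope_noise \<tau>\<^sub>0 n (path \<omega>))"
      by (intro convergent_add convergent_const)
    moreover have "\<forall>\<^sub>F n in sequentially. slope \<tau>\<^sub>0 (path \<omega>) + noise_sum slope_noise \<tau>\<^sub>0 n (path \<omega>) = slope n (path \<omega>)"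
      using eventually_ge_at_top[of \<tau>\<^sub>0]
      by eventually_elim (rule slope_eq_noise_sum[OF initial_size, symmetric])
    ultimately show ?case by (simp add: convergent_cong)
  qed
qed

text \<open>
  By the triangle inequality the normalized sums of absolute labels form a supermartingale, which
  stays below its initial value plus a convergent noise sum.
\<close>

lemma AE_abs_sum_bounded:
  "AE \<omega> in M. \<exists>K. \<forall>\<^sub>F n in sequentially. abs_sum n (path \<omega>) \<le> K * (real n)\<^sup>2"
proof -
  define f where "f = (\<lambda>j z. \<bar>real_of_int z\<bar> / ((real j + 1) * (real j + 2)))"
  have "\<bar>f j z\<bar> = \<bar>real_of_int z\<bar> / ((real j + 1) * (real j + 2))" for j z
    by (simp add: f_def)
  from weighted_label_noise_bounds[OF this] obtain K where K: "K > 0"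
    "\<And>j. \<tau>\<^sub>0 \<le> j \<Longrightarrow> expectation (\<lambda>\<omega>. (f j (path \<omega> (Suc j)))\<^sup>2) \<le> K / (real j + 2)\<^sup>2"
    "\<And>m N. \<tau>\<^sub>0 \<le> m \<Longrightarrow> (\<Sum>j=m..<N. K / (real j + 2)\<^sup>2) \<le> K / real m" by blast
  let ?a = "\<lambda>n x. abs_sum n x / (real n * (real n + 1))"
  have drift: "?a (Suc n) x \<le> ?a n x + noise (f n) n x" if "n \<ge> 1" for n x
  proof -
    have n: "real n \<ge> 1" using that by simp
    have "(\<bar>real_of_int (x (Suc n))\<bar> - 2 * abs_sum n x / n) / ((real n + 1) * (real n + 2))
      \<le> (\<bar>real_of_int (x (Suc n))\<bar> - pair_mean (\<lambda>z. \<bar>real_of_int z\<bar>) n x) / ((real n + 1) * (real n + 2))"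
      by (intro divide_right_mono diff_left_mono pair_mean_abs_le) auto
    also have "\<dots> = noise (f n) n x"
      by (simp add: noise_def f_def pair_mean_divide diff_divide_distrib)
    finally have "(\<bar>real_of_int (x (Suc n))\<bar> - 2 * abs_sum n x / n) / ((real n + 1) * (real n + 2)) \<le> noise (f n) n x" .
    moreover have "?a n x = (abs_sum n x + 2 * abs_sum n x / n) / ((real n + 1) * (real n + 2))"
      using n by (simp add: divide_simps) (simp add: algebra_simps)
    ultimately show ?thesis
      by (simp add: abs_sum_Suc add_divide_distrib diff_divide_distrib algebra_simps)
  qed
  have bound: "?a n x \<le> ?a \<tau>\<^sub>0 x + noise_sum f \<tau>\<^sub>0 n x" if "\<tau>\<^sub>0 \<le> n" for n x
    using that
  proof (induction n rule: dec_induct)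
    case (step n)
    thus ?case using drift[of n x] initial_size
      by (simp add: noise_sum_Suc)
  qed simp
  have "AE \<omega> in M. convergent (\<lambda>n. noise_sum f \<tau>\<^sub>0 n (path \<omega>))"
    by (rule AE_noise_sum_convergent[where c = "\<lambda>j. K / (real j + 2)\<^sup>2"]) (fact K(2), fact K(3))
  thus ?thesis
  proof eventually_elim
    case (elim \<omega>)
    then obtain W where W: "\<And>n. \<bar>noise_sum f \<tau>\<^sub>0 n (path \<omega>)\<bar> \<le> W"
      using convergent_imp_Bseq BseqE by (metis real_norm_def)
    define L where "L = ?a \<tau>\<^sub>0 (path \<omega>) + W"
    have a0: "?a n x \<ge> 0" for n x by (auto simp: abs_sum_def intro!: sum_nonneg divide_nonneg_nonneg)
    have "abs_sum n (path \<omega>) \<le> 2 * L * (real n)\<^sup>2" if n: "\<tau>\<^sub>0 \<le> n" for n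
    proof -
      have n1: "real n \<ge> 1" using n initial_size by simp
      have L: "?a n (path \<omega>) \<le> L" using bound[OF n, of "path \<omega>"] W[of n] unfolding L_def by linarith
      hence "abs_sum n (path \<omega>) \<le> L * (real n * (real n + 1))"
        using n1 by (simp add: pos_divide_le_eq)
      also have "\<dots> \<le> L * (real n * (2 * real n))"
        using L a0[of n "path \<omega>"] n1 by (intro mult_left_mono) auto
      finally show ?thesis by (simp add: power2_eq_square)
    qed
    thus ?case unfolding eventually_sequentially by blast
  qed
qed

text \<open>
  The mean of the square sum at time \<open>L ^ 13\<close> is of order \<open>L ^ 39\<close>, and a spare factor \<open>L\<^sup>2\<close> makes
  Markov's inequality summable.
\<close>

lemma AE_square_sum_eventually_le:
  "AE \<omega> in M. \<forall>\<^sub>F L in sequentially. square_sum (L ^ 13) (path \<omega>) \<le> real L ^ 41"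
proof -
  obtain K where K: "K > 0"
    "\<And>n. \<tau>\<^sub>0 \<le> n \<Longrightarrow> expectation (\<lambda>\<omega>. square_sum n (path \<omega>)) \<le> K * real n ^ 3"
    using moment_growth by metis
  define A where "A = (\<lambda>k. {\<omega> \<in> space M. real (k + \<tau>\<^sub>0) ^ 41 \<le> square_sum ((k + \<tau>\<^sub>0) ^ 13) (path \<omega>)})"
  have int: "integrable M (\<lambda>\<omega>. square_sum n (path \<omega>))" for n
    by (rule integrable_path_depends[OF depends_on_square_sum])
  have sets: "A k \<in> sets M" for k
    unfolding A_def using int[THEN borel_measurable_integrable] by measurable
  have "prob (A k) \<le> K / (real (k + \<tau>\<^sub>0))\<^sup>2" for k
  proof -
    define r where "r = real (k + \<tau>\<^sub>0)"
    have r: "r \<ge> 1" using initial_size by (simp add: r_def)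
    have "\<tau>\<^sub>0 \<le> (k + \<tau>\<^sub>0) ^ 1" by simp
    also have "\<dots> \<le> (k + \<tau>\<^sub>0) ^ 13" using initial_size by (intro power_increasing) auto
    finally have le: "\<tau>\<^sub>0 \<le> (k + \<tau>\<^sub>0) ^ 13" .
    have "prob (A k) \<le> expectation (\<lambda>\<omega>. square_sum ((k + \<tau>\<^sub>0) ^ 13) (path \<omega>)) / r ^ 41"
      unfolding A_def r_def[symmetric]
      using integral_Markov_inequality_measure[OF int, where A = "space M" and c = "r ^ 41"] r
      by (simp add: square_sum_def sum_nonneg)
    also have "\<dots> \<le> K * (r ^ 13) ^ 3 / r ^ 41"
      using K(2)[OF le] r by (intro divide_right_mono) (simp_all add: r_def)
    also have "\<dots> = K / r\<^sup>2"
      using r by (simp add: divide_simps flip: power_add power_mult)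
    finally show ?thesis by (simp add: r_def)
  qed
  from AE_eventually_not[OF sets this] AE_space show ?thesis
  proof eventually_elim
    case (elim \<omega>)
    from elim(1) have "\<forall>\<^sub>F k in sequentially. square_sum ((k + \<tau>\<^sub>0) ^ 13) (path \<omega>) \<le> real (k + \<tau>\<^sub>0) ^ 41"
      by eventually_elim (use elim(2) in \<open>auto simp: A_def\<close>)
    thus ?case
      by (subst (asm) eventually_sequentially_seg[where P = "\<lambda>L. square_sum (L ^ 13) (path \<omega>) \<le> real L ^ 41"])
  qed
qed

text \<open>
  The variance accumulated up to time \<open>L ^ 16\<close> is at most \<open>L ^ 16\<close>, so the level \<open>L ^ 9\<close> is exceeded
  with probability at most \<open>1 / L\<^sup>2\<close>.
\<close>

lemma AE_bounded_noise_eventually_le: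
  fixes F :: "nat \<Rightarrow> int \<Rightarrow> real"
  assumes F: "\<And>L z. \<bar>F L z\<bar> \<le> 1"
  shows "AE \<omega> in M. \<forall>\<^sub>F L in sequentially. \<forall>n\<in>{L ^ 13..L ^ 16}.
    \<bar>noise_sum (\<lambda>_. F L) (L ^ 13) n (path \<omega>)\<bar> \<le> real L ^ 9"
proof -
  define A where "A = (\<lambda>k. let L = k + \<tau>\<^sub>0 in {\<omega> \<in> space M. \<exists>n\<in>{L ^ 13..L ^ 16}.
     real L ^ 9 \<le> \<bar>noise_sum (\<lambda>_. F L) (L ^ 13) n (path \<omega>)\<bar>})"
  have sets: "A k \<in> sets M" for k
    unfolding A_def Let_def by measurable
  have "prob (A k) \<le> 1 / (real (k + \<tau>\<^sub>0))\<^sup>2" for k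
  proof -
    define L where "L = k + \<tau>\<^sub>0"
    have L: "L \<ge> 1" using initial_size by (simp add: L_def)
    have "\<tau>\<^sub>0 \<le> L ^ 1" by (simp add: L_def)
    also have "\<dots> \<le> L ^ 13" using L by (intro power_increasing) auto
    finally have le: "\<tau>\<^sub>0 \<le> L ^ 13" .
    have le': "L ^ 13 \<le> L ^ 16" using L by (intro power_increasing) auto
    have c: "expectation (\<lambda>\<omega>. (F L (path \<omega> (Suc j)))\<^sup>2) \<le> 1" for j
    proof -
      have "expectation (\<lambda>\<omega>. (F L (path \<omega> (Suc j)))\<^sup>2) \<le> expectation (\<lambda>\<omega>. 1)"
        using F by (intro integral_mono integrable_path_depends[OF depends_on_next_label])
          (auto simp: abs_square_le_1)
      thus ?thesis by (simp add: prob_space)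
    qed
    have "prob (A k) \<le> (\<Sum>j=L ^ 13..<L ^ 16. 1) / (real L ^ 9)\<^sup>2"
      unfolding A_def Let_def L_def[symmetric]
      using noise_sum_maximal_ineq[OF le le', of "real L ^ 9" "\<lambda>_. F L" "\<lambda>_. 1"] L c by simp
    also have "\<dots> \<le> real L ^ 16 / (real L ^ 9)\<^sup>2"
      by (intro divide_right_mono) (simp_all add: le')
    also have "\<dots> = 1 / (real L)\<^sup>2"
      using L by (simp add: divide_simps flip: power_add power_mult)
    finally show ?thesis by (simp add: L_def)
  qed
  from AE_eventually_not[OF sets this] AE_space show ?thesis
  proof eventually_elim
    case (elim \<omega>)
    let ?P = "\<lambda>L. \<forall>n\<in>{L ^ 13..L ^ 16}. \<bar>noise_sum (\<lambda>_. F L) (L ^ 13) n (path \<omega>)\<bar> \<le> real L ^ 9"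
    have "\<forall>\<^sub>F k in sequentially. ?P (k + \<tau>\<^sub>0)"
    proof (rule eventually_mono[OF elim(1)], rule ballI, rule ccontr)
      fix k n assume "\<omega> \<notin> A k" and n: "n \<in> {(k + \<tau>\<^sub>0) ^ 13..(k + \<tau>\<^sub>0) ^ 16}"
        and "\<not> \<bar>noise_sum (\<lambda>_. F (k + \<tau>\<^sub>0)) ((k + \<tau>\<^sub>0) ^ 13) n (path \<omega>)\<bar> \<le> real (k + \<tau>\<^sub>0) ^ 9"
      thus False using elim(2) unfolding A_def Let_def by (auto simp only: not_le dest: less_imp_le)
    qed
    thus ?case by (subst (asm) eventually_sequentially_seg[where P = ?P])
  qed
qed

lemma not_AE_slope_tendsto_0:
  assumes nz: "\<exists>i\<in>{1..\<tau>\<^sub>0}. x\<^sub>0 i \<noteq> 0"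
  shows "\<not> (AE \<omega> in M. (\<lambda>n. slope n (path \<omega>)) \<longlonglongrightarrow> 0)"
proof
  assume lim0: "AE \<omega> in M. (\<lambda>n. slope n (path \<omega>)) \<longlonglongrightarrow> 0"
  have "\<bar>slope_noise j z\<bar> = \<bar>real_of_int z\<bar> / ((real j + 1) * (real j + 2))" for j z
    by (simp add: slope_noise_def abs_mult)
  from weighted_label_noise_bounds[OF this] obtain K where K: "K > 0"
    "\<And>j. \<tau>\<^sub>0 \<le> j \<Longrightarrow> expectation (\<lambda>\<omega>. (slope_noise j (path \<omega> (Suc j)))\<^sup>2) \<le> K / (real j + 2)\<^sup>2"
    "\<And>m N. \<tau>\<^sub>0 \<le> m \<Longrightarrow> (\<Sum>j=m..<N. K / (real j + 2)\<^sup>2) \<le> K / real m" by blast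
  define v where "v = (\<lambda>n. expectation (\<lambda>\<omega>. (slope n (path \<omega>))\<^sup>2))"
  have int: "integrable M (\<lambda>\<omega>. (slope n (path \<omega>))\<^sup>2)" for n
    by (rule integrable_path_depends[OF depends_on_square[OF depends_on_slope]])
  have [measurable]: "(\<lambda>\<omega>. slope n (path \<omega>)) \<in> borel_measurable M" for n
    by (rule measurable_path_depends[OF depends_on_slope])
  have mono: "v n \<le> v (Suc n)" if n: "\<tau>\<^sub>0 \<le> n" for n
  proof -
    let ?\<xi> = "noise (slope_noise n) n"
    have int2: "integrable M (\<lambda>\<omega>. slope n (path \<omega>) * ?\<xi> (path \<omega>))"
      by (intro integrable_path_depends[where n = "Suc n"] depends_on_times
        depends_on_mono[OF depends_on_slope] depends_on_noise) auto
    have int3: "integrable M (\<lambda>\<omega>. (?\<xi> (path \<omega>))\<^sup>2)"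
      by (intro integrable_path_depends[where n = "Suc n"] depends_on_square depends_on_noise)
    have "(slope (Suc n) x)\<^sup>2 = (slope n x)\<^sup>2 + 2 * (slope n x * ?\<xi> x) + (?\<xi> x)\<^sup>2" for x
      using n initial_size by (simp add: slope_Suc power2_eq_square algebra_simps)
    hence "v (Suc n) = v n + 2 * expectation (\<lambda>\<omega>. slope n (path \<omega>) * ?\<xi> (path \<omega>)) + expectation (\<lambda>\<omega>. (?\<xi> (path \<omega>))\<^sup>2)"
      using int int2 int3 by (simp add: v_def)
    thus ?thesis by (simp add: expectation_times_noise[OF n depends_on_slope])
  qed
  have pos: "v (Suc \<tau>\<^sub>0) > 0"
  proof -
    have "AE \<omega> in M. square_sum \<tau>\<^sub>0 (path \<omega>) = (\<Sum>i=1..\<tau>\<^sub>0. (real_of_int (x\<^sub>0 i))\<^sup>2)"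
      using AE_path_simulate[OF order_refl]
      by eventually_elim (simp add: square_sum_def simulate_initial)
    hence "expectation (\<lambda>\<omega>. square_sum \<tau>\<^sub>0 (path \<omega>)) = expectation (\<lambda>_. \<Sum>i=1..\<tau>\<^sub>0. (real_of_int (x\<^sub>0 i))\<^sup>2)"
      by (intro integral_cong_AE measurable_path_depends[OF depends_on_square_sum]) auto
    also have "\<dots> = (\<Sum>i=1..\<tau>\<^sub>0. (real_of_int (x\<^sub>0 i))\<^sup>2)" by (simp add: prob_space)
    also have "\<dots> > 0" using nz by (auto intro!: sum_pos2)
    finally have q: "expectation (\<lambda>\<omega>. square_sum \<tau>\<^sub>0 (path \<omega>)) > 0" .
    have "0 < 2 / real \<tau>\<^sub>0 * expectation (\<lambda>\<omega>. square_sum \<tau>\<^sub>0 (path \<omega>))"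
      using q initial_size by simp
    also have "\<dots> \<le> expectation (\<lambda>\<omega>. (real_of_int (path \<omega> (Suc \<tau>\<^sub>0)))\<^sup>2)"
      unfolding expectation_next_square[OF order_refl] by simp
    also have "\<dots> \<le> expectation (\<lambda>\<omega>. (label_sum (Suc \<tau>\<^sub>0) (path \<omega>))\<^sup>2)"
      unfolding expectation_label_sum_square_Suc[OF order_refl] by simp
    finally have "0 < expectation (\<lambda>\<omega>. (label_sum (Suc \<tau>\<^sub>0) (path \<omega>))\<^sup>2)" .
    thus ?thesis by (simp add: v_def slope_def power_divide)
  qed
  have lower: "v (Suc \<tau>\<^sub>0) \<le> v n" if "Suc \<tau>\<^sub>0 \<le> n" for n
    using that
  proof (induction n rule: dec_induct)
    case (step n)
    thus ?case using mono[of n] by simp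
  qed simp
  \<comment> \<open>If the limit were 0, Fatou's lemma would bound \<open>v m\<close> by the variance of all increments
    after time \<open>m\<close>, which tends to 0.\<close>
  have upper: "v m \<le> K / real m" if m: "\<tau>\<^sub>0 \<le> m" for m
  proof -
    let ?u = "\<lambda>n \<omega>. ennreal ((slope n (path \<omega>) - slope m (path \<omega>))\<^sup>2)"
    have "ennreal (v m) = (\<integral>\<^sup>+\<omega>. ennreal ((slope m (path \<omega>))\<^sup>2) \<partial>M)"
      unfolding v_def by (rule nn_integral_eq_integral[symmetric]) (use int in auto)
    also have "\<dots> = (\<integral>\<^sup>+\<omega>. liminf (\<lambda>n. ?u n \<omega>) \<partial>M)"
    proof (rule nn_integral_cong_AE, use lim0 in eventually_elim)
      case (elim \<omega>)
      have "(\<lambda>n. ?u n \<omega>) \<longlonglongrightarrow> ennreal ((0 - slope m (path \<omega>))\<^sup>2)"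
        by (intro tendsto_intros tendsto_ennrealI elim)
      from lim_imp_Liminf[OF sequentially_bot this] show ?case by simp
    qed
    also have "\<dots> \<le> liminf (\<lambda>n. \<integral>\<^sup>+\<omega>. ?u n \<omega> \<partial>M)"
      by (rule nn_integral_liminf) measurable
    also have "\<dots> \<le> liminf (\<lambda>n. ennreal (K / real m))"
    proof (rule Liminf_mono, use eventually_ge_at_top[of m] in eventually_elim)
      case (elim n)
      have "slope n x - slope m x = noise_sum slope_noise m n x" for x
        using slope_eq_noise_sum[of m n x] elim m initial_size by simp
      hence "(\<integral>\<^sup>+\<omega>. ?u n \<omega> \<partial>M) = ennreal (expectation (\<lambda>\<omega>. (noise_sum slope_noise m n (path \<omega>))\<^sup>2))"
        by (subst nn_integral_eq_integral[symmetric])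
           (auto intro!: integrable_path_depends[OF depends_on_square[OF depends_on_noise_sum]])
      also have "\<dots> \<le> ennreal (K / real m)"
        using expectation_noise_sum_square_le[OF m elim, of slope_noise "\<lambda>j. K / (real j + 2)\<^sup>2"]
          K(2)[OF order_trans[OF m]] K(3)[OF m, of n] by (intro ennreal_leI) auto
      finally show ?case .
    qed
    also have "\<dots> = ennreal (K / real m)" by (simp add: Liminf_const)
    finally show ?thesis using K(1) by (subst (asm) ennreal_le_iff) auto
  qed
  obtain m0 :: nat where m0: "K / v (Suc \<tau>\<^sub>0) < m0" using reals_Archimedean2 by blast
  define m where "m = m0 + Suc \<tau>\<^sub>0"
  have "K / v (Suc \<tau>\<^sub>0) < m" using m0 by (simp add: m_def)
  hence "K / real m < v (Suc \<tau>\<^sub>0)" using pos by (simp add: m_def field_simps)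
  moreover have "v (Suc \<tau>\<^sub>0) \<le> K / real m"
    using lower[of m] upper[of m] by (simp add: m_def)
  ultimately show False by simp
qed

end

section \<open>Characteristic functions of the empirical measures\<close>

definition urn_char :: "(nat \<Rightarrow> int) \<Rightarrow> nat \<Rightarrow> real \<Rightarrow> complex" where
  "urn_char x n \<theta> = (\<Sum>i=1..n. cis (\<theta> * x i)) / of_nat n"

text \<open>The characteristic function of the exponential distribution of rate one.\<close>

definition limit_char :: "real \<Rightarrow> complex" where
  "limit_char s = 1 / (1 - \<i> * s)"

lemma norm_urn_char_le_1: "cmod (urn_char x n \<theta>) \<le> 1"
proof (cases "n = 0")
  case False
  have "cmod (\<Sum>i=1..n. cis (\<theta> * x i)) \<le> (\<Sum>i=1..n. cmod (cis (\<theta> * x i)))"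
    by (rule norm_sum)
  also have "\<dots> = real n" by simp
  finally show ?thesis using False by (simp add: urn_char_def norm_divide field_simps)
qed (simp add: urn_char_def)

lemma norm_one_minus_imaginary_ge: "1 \<le> cmod (1 - \<i> * complex_of_real s)"
  using abs_Re_le_cmod[of "1 - \<i> * complex_of_real s"] by simp

lemma one_minus_imaginary_nonzero: "1 - \<i> * complex_of_real s \<noteq> 0"
  using norm_one_minus_imaginary_ge[of s] by auto

lemma norm_limit_char_le_1: "cmod (limit_char s) \<le> 1"
  using norm_one_minus_imaginary_ge[of s]
  by (simp add: limit_char_def norm_divide divide_simps)

lemma limit_char_diff: "limit_char s - limit_char t = \<i> * (s - t) * limit_char s * limit_char t"
  using one_minus_imaginary_nonzero[of s] one_minus_imaginary_nonzero[of t]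
  by (simp add: limit_char_def divide_simps) (simp add: algebra_simps)

lemma limit_char_taylor: "cmod (limit_char s - (1 + \<i> * s)) \<le> s\<^sup>2"
proof -
  have "limit_char s - (1 + \<i> * s) = - (s\<^sup>2 * limit_char s)"
    using one_minus_imaginary_nonzero[of s]
    by (simp add: limit_char_def divide_simps) (simp add: algebra_simps power2_eq_square)
  hence "cmod (limit_char s - (1 + \<i> * s)) = s\<^sup>2 * cmod (limit_char s)"
    by (simp add: norm_mult norm_power)
  also have "\<dots> \<le> s\<^sup>2 * 1"
    by (intro mult_left_mono norm_limit_char_le_1) auto
  finally show ?thesis by simp
qed

lemma norm_cis_minus_linear_le: "cmod (cis s - (1 + \<i> * s)) \<le> s\<^sup>2 / 2"
  using iexp_approx1[of s 1] by (simp add: cis_conv_exp power2_eq_square)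

lemma norm_cis_diff_le: "cmod (cis s - cis t) \<le> \<bar>s - t\<bar>"
proof -
  have "cis s - cis t = cis t * (cis (s - t) - 1)"
    by (simp add: right_diff_distrib cis_mult)
  hence "cmod (cis s - cis t) = cmod (cis (s - t) - 1)" by (simp add: norm_mult)
  also have "\<dots> \<le> \<bar>s - t\<bar>"
    using iexp_approx1[of "s - t" 0] by (simp add: cis_conv_exp)
  finally show ?thesis .
qed

lemma urn_char_taylor:
  assumes "n \<ge> 1"
  shows "cmod (urn_char x n \<theta> - (1 + \<i> * (\<theta> * label_sum n x / n))) \<le> \<theta>\<^sup>2 * square_sum n x / n"
proof -
  have n: "n > 0" using assms by simp
  have "urn_char x n \<theta> - (1 + \<i> * (\<theta> * label_sum n x / n))
     = (\<Sum>i=1..n. cis (\<theta> * x i) - (1 + \<i> * of_real (\<theta> * x i))) / of_nat n"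
    using n unfolding urn_char_def label_sum_def
    by (simp add: sum_subtractf sum.distrib diff_divide_distrib add_divide_distrib sum_distrib_left)
  hence "cmod (urn_char x n \<theta> - (1 + \<i> * (\<theta> * label_sum n x / n)))
     = cmod (\<Sum>i=1..n. cis (\<theta> * x i) - (1 + \<i> * of_real (\<theta> * x i))) / n"
    by (simp add: norm_divide)
  also have "\<dots> \<le> (\<Sum>i=1..n. (\<theta> * x i)\<^sup>2) / n"
  proof (intro divide_right_mono sum_norm_le)
    fix i
    show "cmod (cis (\<theta> * x i) - (1 + \<i> * of_real (\<theta> * x i))) \<le> (\<theta> * x i)\<^sup>2"
      using norm_cis_minus_linear_le[of "\<theta> * x i"] zero_le_power2[of "\<theta> * x i"] by linarith
  qed simp
  also have "\<dots> = \<theta>\<^sup>2 * square_sum n x / n"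
    by (simp add: square_sum_def power_mult_distrib sum_distrib_left)
  finally show ?thesis .
qed

lemma norm_urn_char_diff_le:
  "cmod (urn_char x n s - urn_char x n t) \<le> \<bar>s - t\<bar> * abs_sum n x / n"
proof -
  have "cmod (urn_char x n s - urn_char x n t) = cmod (\<Sum>i=1..n. cis (s * x i) - cis (t * x i)) / n"
    by (simp add: urn_char_def norm_divide sum_subtractf flip: diff_divide_distrib)
  also have "\<dots> \<le> (\<Sum>i=1..n. \<bar>s - t\<bar> * \<bar>real_of_int (x i)\<bar>) / n"
  proof (intro divide_right_mono sum_norm_le)
    fix i
    show "cmod (cis (s * x i) - cis (t * x i)) \<le> \<bar>s - t\<bar> * \<bar>real_of_int (x i)\<bar>"
      using norm_cis_diff_le[of "s * x i" "t * x i"] by (simp flip: left_diff_distrib abs_mult)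
  qed simp
  finally show ?thesis by (simp add: abs_sum_def sum_distrib_left)
qed

text \<open>
  The characteristic function of a sum of two independent draws is the square of that of one draw.
\<close>

lemma urn_char_square:
  "(urn_char x n \<theta>)\<^sup>2 =
     Complex (pair_mean (\<lambda>z. cos (\<theta> * z)) n x) (pair_mean (\<lambda>z. sin (\<theta> * z)) n x)"
proof -
  have "(urn_char x n \<theta>)\<^sup>2 = (\<Sum>i=1..n. \<Sum>j=1..n. cis (\<theta> * x i) * cis (\<theta> * x j)) / of_real ((real n)\<^sup>2)"
    by (simp add: urn_char_def power_divide power2_eq_square sum_product)
  also have "\<dots> = (\<Sum>i=1..n. \<Sum>j=1..n. cis (\<theta> * real_of_int (x i + x j))) / of_real ((real n)\<^sup>2)"
    by (simp add: cis_mult distrib_left)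
  also have "\<dots> = Complex (pair_mean (\<lambda>z. cos (\<theta> * z)) n x) (pair_mean (\<lambda>z. sin (\<theta> * z)) n x)"
    by (intro complex_eqI) (simp_all only: pair_mean_def Re_divide_of_real Im_divide_of_real Re_sum Im_sum complex.sel cis.sel)
  finally show ?thesis .
qed

lemma cis_next_label:
  fixes \<theta> :: real
  shows "cis (\<theta> * x (Suc n)) = (urn_char x n \<theta>)\<^sup>2 +
     Complex (noise (\<lambda>z. cos (\<theta> * z)) n x) (noise (\<lambda>z. sin (\<theta> * z)) n x)"
  unfolding urn_char_square noise_def by (simp add: complex_eq_iff)

lemma Complex_sum: "Complex (\<Sum>i\<in>A. f i) (\<Sum>i\<in>A. g i) = (\<Sum>i\<in>A. Complex (f i) (g i))"
  by (simp add: complex_eq_iff)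

section \<open>Stability of the recursion for characteristic functions\<close>

text \<open>
  The factor \<open>n * (n + 1) / (m * (m + 1))\<close> satisfies the hypothesis for \<open>G = 1\<close> with equality.
\<close>

lemma discrete_gronwall:
  fixes e :: "nat \<Rightarrow> real"
  assumes "1 \<le> m" and bound: "\<And>n. \<lbrakk>m \<le> n; n \<le> N\<rbrakk> \<Longrightarrow> e n \<le> G + (\<Sum>j=m..<n. 2 * e j / real j)"
    and n: "m \<le> n" "n \<le> N"
  shows "e n \<le> G * (real n * (n + 1) / (m * (m + 1)))"
  using n
proof (induction n rule: less_induct)
  case (less n)
  let ?p = "\<lambda>n. real n * (n + 1) / (m * (m + 1))"
  have telescope: "(\<Sum>j=m..<n. 2 * ?p j / real j) = ?p n - ?p m"
  proof -
    have "(\<Sum>j=m..<n. 2 * ?p j / real j) = (\<Sum>j=m..<n. ?p (Suc j) - ?p j)"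
      using \<open>1 \<le> m\<close> by (intro sum.cong refl) (auto simp: divide_simps, simp add: algebra_simps)
    also have "\<dots> = ?p n - ?p m"
      using sum_Suc_diff'[of m n ?p] less.prems by simp
    finally show ?thesis .
  qed
  have "(\<Sum>j=m..<n. 2 * e j / real j) \<le> (\<Sum>j=m..<n. G * (2 * ?p j / real j))"
  proof (rule sum_mono)
    fix j assume j: "j \<in> {m..<n}"
    have "e j \<le> G * ?p j" using less.IH[of j] j less.prems by auto
    hence "2 * e j / real j \<le> 2 * (G * ?p j) / real j"
      by (intro divide_right_mono mult_left_mono) auto
    thus "2 * e j / real j \<le> G * (2 * ?p j / real j)"
      by (simp only: times_divide_eq_right mult.left_commute)
  qed
  also have "\<dots> = G * (?p n - ?p m)"
    unfolding telescope[symmetric] by (simp only: sum_distrib_left)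
  finally have "e n \<le> G + G * (?p n - ?p m)"
    using bound[of n] less.prems by linarith
  moreover have "?p m = 1"
  proof -
    have "real m * (m + 1) = real (m * (m + 1))" by (simp only: of_nat_mult)
    moreover have "real (m * (m + 1)) \<noteq> 0" using \<open>1 \<le> m\<close> by (simp only: of_nat_eq_0_iff) simp
    ultimately show ?thesis by (metis divide_self)
  qed
  ultimately show ?case by (simp add: algebra_simps)
qed

text \<open>
  Both characteristic functions have modulus at most one, so the difference of their squares is at
  most twice their difference; this is the factor 2 that Gronwall's inequality expects.
\<close>

lemma urn_char_stability:
  fixes x :: "nat \<Rightarrow> int" and \<theta> a w :: real
  defines "c \<equiv> \<lambda>_ z. cos (\<theta> * real_of_int z)" and "s \<equiv> \<lambda>_ z. sin (\<theta> * real_of_int z)"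
  assumes m: "1 \<le> m" "m \<le> N"
    and w: "\<And>n. \<lbrakk>m \<le> n; n \<le> N\<rbrakk> \<Longrightarrow>
          \<bar>noise_sum c m n x\<bar> \<le> w \<and> \<bar>noise_sum s m n x\<bar> \<le> w"
  shows "cmod (urn_char x N \<theta> - limit_char (a * N)) \<le>
    (m * cmod (urn_char x m \<theta> - limit_char (a * m)) + 2 * w + \<bar>a\<bar> * N) * (real N / (real m)\<^sup>2)"
proof -
  define \<phi> where "\<phi> = (\<lambda>n. urn_char x n \<theta>)"
  define \<psi> where "\<psi> = (\<lambda>n::nat. limit_char (a * n))"
  define E where "E = (\<lambda>n. of_nat n * (\<phi> n - \<psi> n))"
  define \<xi> where "\<xi> = (\<lambda>n. Complex (noise (c n) n x) (noise (s n) n x))"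
  define b where "b = (\<lambda>n. \<psi> n * (\<psi> n - \<psi> (Suc n)))"
  define G where "G = cmod (E m) + 2 * w + \<bar>a\<bar> * N"
  have \<phi>1: "cmod (\<phi> n) \<le> 1" and \<psi>1: "cmod (\<psi> n) \<le> 1" for n
    by (simp_all add: \<phi>_def \<psi>_def norm_urn_char_le_1 norm_limit_char_le_1)
  have \<phi>_rec: "of_nat (Suc n) * \<phi> (Suc n) = of_nat n * \<phi> n + (\<phi> n)\<^sup>2 + \<xi> n" if "n \<ge> 1" for n
  proof -
    have "of_nat (Suc n) * \<phi> (Suc n) = of_nat n * \<phi> n + cis (\<theta> * x (Suc n))"
      using that by (simp add: \<phi>_def urn_char_def del: of_nat_Suc)
    thus ?thesis unfolding cis_next_label by (simp add: \<phi>_def \<xi>_def c_def s_def)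
  qed
  have \<psi>_rec: "of_nat (Suc n) * \<psi> (Suc n) = of_nat n * \<psi> n + \<psi> n * \<psi> (Suc n)" for n
    unfolding \<psi>_def limit_char_def
    using one_minus_imaginary_nonzero[of "a * n"] one_minus_imaginary_nonzero[of "a * Suc n"]
    by (simp add: divide_simps) (simp add: algebra_simps)
  \<comment> \<open>The difference of the two squares factors, which makes the recursion linear in \<open>E\<close> up to
    the noise \<open>\<xi>\<close> and the discretization error \<open>b\<close> of the limit equation.\<close>
  have E_rec: "E (Suc n) - E n = E n * (\<phi> n + \<psi> n) / of_nat n + (\<xi> n + b n)" if "n \<ge> 1" for n
  proof -
    have "E n * (\<phi> n + \<psi> n) / of_nat n = (\<phi> n)\<^sup>2 - (\<psi> n)\<^sup>2"
    proof -
      have "E n * (\<phi> n + \<psi> n) / of_nat n = (\<phi> n - \<psi> n) * (\<phi> n + \<psi> n)"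
        using that by (simp add: E_def)
      thus ?thesis by (simp add: power2_eq_square algebra_simps)
    qed
    moreover have "E (Suc n) - E n = (\<phi> n)\<^sup>2 + \<xi> n - \<psi> n * \<psi> (Suc n)"
      using \<phi>_rec[OF that] \<psi>_rec[of n] unfolding E_def right_diff_distrib by algebra
    ultimately show ?thesis by (simp add: b_def algebra_simps power2_eq_square)
  qed
  have b: "cmod (b n) \<le> \<bar>a\<bar>" for n
  proof -
    have *: "cmod (\<psi> n - \<psi> (Suc n)) = \<bar>a\<bar> * (cmod (\<psi> n) * cmod (\<psi> (Suc n)))"
      unfolding \<psi>_def limit_char_diff
      by (simp add: norm_mult mult.assoc algebra_simps del: of_real_add of_real_diff of_real_mult)
    have "cmod (b n) = cmod (\<psi> n) * (\<bar>a\<bar> * (cmod (\<psi> n) * cmod (\<psi> (Suc n))))"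
      by (simp add: b_def norm_mult *)
    also have "\<dots> \<le> 1 * (\<bar>a\<bar> * (1 * 1))"
      by (intro mult_mono \<psi>1) auto
    finally show ?thesis by simp
  qed
  have bound: "cmod (E n) \<le> G + (\<Sum>j=m..<n. 2 * cmod (E j) / real j)" if n: "m \<le> n" "n \<le> N" for n
  proof -
    have "E n - E m = (\<Sum>j=m..<n. E (Suc j) - E j)"
      using sum_Suc_diff'[of m n E] n by simp
    also have "\<dots> = (\<Sum>j=m..<n. E j * (\<phi> j + \<psi> j) / of_nat j + (\<xi> j + b j))"
      using m by (intro sum.cong E_rec refl) auto
    finally have En: "E n = E m + (\<Sum>j=m..<n. E j * (\<phi> j + \<psi> j) / of_nat j) + (\<Sum>j=m..<n. \<xi> j) + (\<Sum>j=m..<n. b j)"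
      by (simp add: sum.distrib algebra_simps)
    have "cmod (\<Sum>j=m..<n. E j * (\<phi> j + \<psi> j) / of_nat j) \<le> (\<Sum>j=m..<n. 2 * cmod (E j) / real j)"
    proof (rule sum_norm_le)
      fix j
      have "cmod (\<phi> j + \<psi> j) \<le> 2" using norm_triangle_ineq[of "\<phi> j" "\<psi> j"] \<phi>1[of j] \<psi>1[of j] by linarith
      hence "cmod (E j) * cmod (\<phi> j + \<psi> j) \<le> cmod (E j) * 2" by (intro mult_left_mono) auto
      thus "cmod (E j * (\<phi> j + \<psi> j) / of_nat j) \<le> 2 * cmod (E j) / real j"
        by (simp add: norm_mult norm_divide divide_right_mono mult.commute)
    qed
    moreover have "cmod (\<Sum>j=m..<n. \<xi> j) \<le> 2 * w"
    proof -
      have "(\<Sum>j=m..<n. \<xi> j) = Complex (noise_sum c m n x) (noise_sum s m n x)"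
        by (simp add: \<xi>_def noise_sum_def Complex_sum)
      thus ?thesis using cmod_le[of "\<Sum>j=m..<n. \<xi> j"] w[OF n] by auto
    qed
    moreover have "cmod (\<Sum>j=m..<n. b j) \<le> \<bar>a\<bar> * N"
    proof -
      have "cmod (\<Sum>j=m..<n. b j) \<le> (\<Sum>j=m..<n. \<bar>a\<bar>)" by (intro sum_norm_le b)
      also have "\<dots> = \<bar>a\<bar> * (n - m)" by simp
      also have "\<dots> \<le> \<bar>a\<bar> * N" using n by (intro mult_left_mono) auto
      finally show ?thesis .
    qed
    ultimately show ?thesis
      using norm_triangle_ineq[of "E m + (\<Sum>j=m..<n. E j * (\<phi> j + \<psi> j) / of_nat j) + (\<Sum>j=m..<n. \<xi> j)" "\<Sum>j=m..<n. b j"]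
        norm_triangle_ineq[of "E m + (\<Sum>j=m..<n. E j * (\<phi> j + \<psi> j) / of_nat j)" "\<Sum>j=m..<n. \<xi> j"]
        norm_triangle_ineq[of "E m" "\<Sum>j=m..<n. E j * (\<phi> j + \<psi> j) / of_nat j"]
      unfolding En G_def by linarith
  qed
  have "w \<ge> 0" using w[of m] m by auto
  hence G: "G \<ge> 0" by (simp add: G_def)
  have "real N * cmod (\<phi> N - \<psi> N) = cmod (E N)"
    by (simp add: E_def norm_mult)
  also have "\<dots> \<le> G * (real N * (N + 1) / (m * (m + 1)))"
    using discrete_gronwall[OF m(1) bound, of N N] m by simp
  also have "\<dots> \<le> G * (real N * N / (real m * m))"
  proof -
    have "(real N + 1) * m \<le> N * (real m + 1)" using m by (simp add: algebra_simps)
    hence "(N + 1) / (m + 1) \<le> real N / m" using m by (simp add: divide_simps add.commute)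
    hence "real N / m * ((N + 1) / (m + 1)) \<le> real N / m * (real N / m)"
      by (intro mult_left_mono) auto
    thus ?thesis using G by (intro mult_left_mono) (simp_all add: algebra_simps)
  qed
  finally have "cmod (\<phi> N - \<psi> N) \<le> G * (N / (real m)\<^sup>2)"
    using m by (simp add: field_simps power2_eq_square)
  moreover have "G = m * cmod (\<phi> m - \<psi> m) + 2 * w + \<bar>a\<bar> * N"
    by (simp add: G_def E_def norm_mult)
  ultimately show ?thesis by (simp add: \<phi>_def \<psi>_def)
qed

section \<open>Convergence of characteristic functions\<close>

text \<open>
  Between \<open>m = L ^ 13\<close> and \<open>N = L ^ 16\<close> errors of the characteristic function at time \<open>m\<close> grow by the
  factor \<open>m / N * (N / m)\<^sup>2 = L ^ 3\<close>, and the accumulated noise \<open>L ^ 9\<close> contributes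
  \<open>L ^ 9 * N / m\<^sup>2 = 1 / L\<close>. The error at time \<open>m\<close> is \<open>o(1 / L ^ 3)\<close>: the first-order term because
  the slope converges, the second-order term because the square sum is at most \<open>L ^ 41\<close>.
\<close>

lemma urn_char_tendsto_along_powers:
  fixes x :: "nat \<Rightarrow> int" and A t :: real
  assumes slope: "(\<lambda>n. label_sum n x / (real n * (real n + 1))) \<longlonglongrightarrow> A"
    and sq: "\<forall>\<^sub>F L in sequentially. square_sum (L ^ 13) x \<le> real L ^ 41"
    and noise_cos: "\<forall>\<^sub>F L in sequentially. \<forall>n\<in>{L ^ 13..L ^ 16}.
      \<bar>noise_sum (\<lambda>_ z. cos (t / real L ^ 16 * real_of_int z)) (L ^ 13) n x\<bar> \<le> real L ^ 9"
    and noise_sin: "\<forall>\<^sub>F L in sequentially. \<forall>n\<in>{L ^ 13..L ^ 16}.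
      \<bar>noise_sum (\<lambda>_ z. sin (t / real L ^ 16 * real_of_int z)) (L ^ 13) n x\<bar> \<le> real L ^ 9"
  shows "(\<lambda>L. urn_char x (L ^ 16) (t / real L ^ 16)) \<longlonglongrightarrow> limit_char (A * t)"
proof -
  define \<delta> where "\<delta> = (\<lambda>L::nat. \<bar>label_sum (L ^ 13) x / (real (L ^ 13) * (real (L ^ 13) + 1)) - A\<bar>)"
  have pow: "filterlim (\<lambda>L::nat. L ^ 13) sequentially sequentially"
    by (rule filterlim_subseq) (auto intro!: strict_monoI power_strict_mono)
  have \<delta>: "\<delta> \<longlonglongrightarrow> 0"
    using tendsto_rabs[OF LIM_zero[OF filterlim_compose[OF slope pow]]] by (simp add: \<delta>_def)
  define err where "err = (\<lambda>L::nat. (\<bar>t\<bar> * \<delta> L + \<bar>t\<bar> * (\<delta> L + \<bar>A\<bar>) / real L ^ 13 + t\<^sup>2 / real L + (A * t)\<^sup>2 / real L ^ 3)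
      + 2 / real L + \<bar>A * t\<bar> / real L ^ 10)"
  have inv_pow: "(\<lambda>L. inverse (real L ^ k)) \<longlonglongrightarrow> 0" if "k > 0" for k
    by (intro tendsto_inverse_0_at_top filterlim_pow_at_top that filterlim_real_sequentially)
  have "err \<longlonglongrightarrow> (\<bar>t\<bar> * 0 + \<bar>t\<bar> * (0 + \<bar>A\<bar>) * 0 + t\<^sup>2 * 0 + (A * t)\<^sup>2 * 0) + 2 * 0 + \<bar>A * t\<bar> * 0"
    unfolding err_def divide_inverse
    by (intro tendsto_intros \<delta> inv_pow lim_inverse_n) simp_all
  hence err: "err \<longlonglongrightarrow> 0" by simp
  have "\<forall>\<^sub>F L in sequentially. cmod (urn_char x (L ^ 16) (t / real L ^ 16) - limit_char (A * t)) \<le> err L"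
    using sq noise_cos noise_sin eventually_ge_at_top[of 1]
  proof eventually_elim
    case (elim L)
    define r where "r = real L"
    define m where "m = L ^ 13"
    define N where "N = L ^ 16"
    define \<theta> where "\<theta> = t / real L ^ 16"
    define a where "a = A * t / real L ^ 16"
    have r: "r \<ge> 1" using elim by (simp add: r_def)
    have m: "1 \<le> m" "m \<le> N" using elim by (auto simp: m_def N_def intro!: power_increasing)
    have rm: "real m = r ^ 13" and rN: "real N = r ^ 16" by (simp_all add: m_def N_def r_def)
    have aN: "a * real N = A * t" and am: "a * real m = A * t / r ^ 3" and \<theta>m: "\<theta> * real m = t / r ^ 3"
      using r by (auto simp: a_def \<theta>_def rm rN r_def[symmetric] divide_simps simp flip: power_add)
    \<comment> \<open>At time \<open>m\<close> the scaled frequency \<open>\<theta> * m = t / r ^ 3\<close> is small, so both characteristic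
      functions are close to \<open>1 + \<i> * a * m\<close>.\<close>
    have start: "cmod (urn_char x m \<theta> - limit_char (a * m))
      \<le> (\<bar>t\<bar> * \<delta> L + \<bar>t\<bar> * (\<delta> L + \<bar>A\<bar>) / r ^ 13 + t\<^sup>2 / r + (A * t)\<^sup>2 / r ^ 3) / r ^ 3"
    proof -
      define S where "S = label_sum m x / (real m * (real m + 1))"
      have S: "\<bar>S - A\<bar> = \<delta> L" by (simp add: S_def \<delta>_def m_def)
      have 1: "cmod (urn_char x m \<theta> - (1 + \<i> * (\<theta> * label_sum m x / m))) \<le> t\<^sup>2 / r / r ^ 3"
      proof -
        have "cmod (urn_char x m \<theta> - (1 + \<i> * (\<theta> * label_sum m x / m))) \<le> \<theta>\<^sup>2 * square_sum m x / m"
          by (rule urn_char_taylor[OF m(1)])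
        also have "\<dots> \<le> \<theta>\<^sup>2 * r ^ 41 / r ^ 13"
          unfolding rm using elim(1) r by (intro divide_right_mono mult_left_mono) (auto simp: m_def r_def)
        also have "\<dots> = t\<^sup>2 / r / r ^ 3"
          using r by (simp add: \<theta>_def r_def[symmetric] power_divide divide_simps flip: power_add power_mult power_Suc)
        finally show ?thesis .
      qed
      have E1: "\<theta> * label_sum m x / m = t / r ^ 3 * S * (1 + 1 / r ^ 13)"
      proof -
        have "label_sum m x / m = S * (real m + 1)" using m by (simp add: S_def)
        hence "\<theta> * label_sum m x / m = \<theta> * m * S * (1 + 1 / m)" using m by (simp add: field_simps)
        thus ?thesis unfolding \<theta>m by (simp add: rm)
      qed
      have "\<theta> * label_sum m x / m - a * m = (t * (S - A) + t * S / r ^ 13) / r ^ 3"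
        unfolding am E1 by (simp add: diff_divide_distrib add_divide_distrib algebra_simps)
      hence "\<bar>\<theta> * label_sum m x / m - a * m\<bar> = \<bar>t * (S - A) + t * S / r ^ 13\<bar> / r ^ 3"
        using r by simp
      also have "\<dots> \<le> (\<bar>t\<bar> * \<delta> L + \<bar>t\<bar> * (\<delta> L + \<bar>A\<bar>) / r ^ 13) / r ^ 3"
      proof (intro divide_right_mono order_trans[OF abs_triangle_ineq] add_mono)
        show "\<bar>t * (S - A)\<bar> \<le> \<bar>t\<bar> * \<delta> L" by (simp add: abs_mult S)
        have "\<bar>S\<bar> \<le> \<delta> L + \<bar>A\<bar>" using S by linarith
        thus "\<bar>t * S / r ^ 13\<bar> \<le> \<bar>t\<bar> * (\<delta> L + \<bar>A\<bar>) / r ^ 13"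
          using r by (simp add: abs_mult divide_right_mono mult_left_mono)
      qed (use r in simp)
      finally have bnd: "\<bar>\<theta> * label_sum m x / m - a * m\<bar>
          \<le> (\<bar>t\<bar> * \<delta> L + \<bar>t\<bar> * (\<delta> L + \<bar>A\<bar>) / r ^ 13) / r ^ 3" .
      have 2: "cmod ((1 + \<i> * (\<theta> * label_sum m x / m)) - (1 + \<i> * of_real (a * m)))
         \<le> (\<bar>t\<bar> * \<delta> L + \<bar>t\<bar> * (\<delta> L + \<bar>A\<bar>) / r ^ 13) / r ^ 3"
      proof -
        have "(1 + \<i> * (\<theta> * label_sum m x / m)) - (1 + \<i> * of_real (a * m))
            = \<i> * of_real (\<theta> * label_sum m x / m - a * m)" by (simp add: algebra_simps)
        hence "cmod ((1 + \<i> * (\<theta> * label_sum m x / m)) - (1 + \<i> * of_real (a * m)))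
            = \<bar>\<theta> * label_sum m x / m - a * m\<bar>" by (simp only: norm_mult norm_ii norm_of_real mult_1)
        thus ?thesis using bnd by simp
      qed
      have 3: "cmod (limit_char (a * m) - (1 + \<i> * of_real (a * m))) \<le> (A * t)\<^sup>2 / r ^ 3 / r ^ 3"
        using limit_char_taylor[of "a * m"] unfolding am by (simp add: power_divide flip: power_add power_mult)
      have "cmod (urn_char x m \<theta> - limit_char (a * m)) \<le>
          cmod (urn_char x m \<theta> - (1 + \<i> * (\<theta> * label_sum m x / m)))
        + cmod ((1 + \<i> * (\<theta> * label_sum m x / m)) - (1 + \<i> * of_real (a * m)))
        + cmod (limit_char (a * m) - (1 + \<i> * of_real (a * m)))"
        by norm
      with 1 2 3 show ?thesis by (simp add: add_divide_distrib)
    qed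
    have "cmod (urn_char x N \<theta> - limit_char (a * N)) \<le>
      (m * cmod (urn_char x m \<theta> - limit_char (a * m)) + 2 * r ^ 9 + \<bar>a\<bar> * N) * (real N / (real m)\<^sup>2)"
      by (rule urn_char_stability[OF m]) (use elim(2,3) in \<open>auto simp: m_def N_def \<theta>_def r_def\<close>)
    also have "\<dots> \<le> (m * ((\<bar>t\<bar> * \<delta> L + \<bar>t\<bar> * (\<delta> L + \<bar>A\<bar>) / r ^ 13 + t\<^sup>2 / r + (A * t)\<^sup>2 / r ^ 3) / r ^ 3) + 2 * r ^ 9 + \<bar>a\<bar> * N)
        * (real N / (real m)\<^sup>2)"
      using start by (intro mult_right_mono add_right_mono mult_left_mono) auto
    also have "\<dots> = err L"
    proof -
      have "\<bar>a\<bar> * real N = \<bar>A * t\<bar>" using aN by (metis abs_mult abs_of_nat)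
      moreover have "real N / (real m)\<^sup>2 = 1 / r ^ 10"
        using r by (simp add: rm rN divide_simps flip: power_add power_mult)
      moreover have "(r ^ 13 * (X / r ^ 3) + 2 * r ^ 9 + Y) * (1 / r ^ 10) = X + 2 / r + Y / r ^ 10" for X Y
        using r by (simp add: divide_simps) (simp add: algebra_simps flip: power_add power_Suc)
      ultimately show ?thesis unfolding err_def rm by (simp only: r_def)
    qed
    finally show ?case unfolding aN by (simp only: N_def \<theta>_def)
  qed
  from Lim_null_comparison[OF this err] show ?thesis
    by (simp add: LIM_zero_iff)
qed

lemma exists_power_bracket: "k > 0 \<Longrightarrow> \<exists>L::nat. L ^ k \<le> n \<and> n < Suc L ^ k"
proof (induction n)
  case (Suc n)
  then obtain L where L: "L ^ k \<le> n" "n < Suc L ^ k" by blast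
  show ?case
  proof (cases "Suc n < Suc L ^ k")
    case False
    hence "Suc L ^ k = Suc n" using L by simp
    moreover have "Suc L ^ k < Suc (Suc L) ^ k" using Suc.prems by (intro power_strict_mono) auto
    ultimately show ?thesis by (metis order_refl)
  next
    case True
    thus ?thesis using L by (intro exI[of _ L]) auto
  qed
qed (auto intro!: exI[of _ 0])

lemma norm_urn_char_grow:
  assumes "1 \<le> m" "m \<le> n"
  shows "cmod (urn_char x n \<theta> - urn_char x m \<theta>) \<le> 2 * (real n - real m) / real m"
proof -
  have n: "real n > 0" and m: "real m > 0" using assms by auto
  have "of_nat n * urn_char x n \<theta> = of_nat m * urn_char x m \<theta> + (\<Sum>i=Suc m..n. cis (\<theta> * x i))"
  proof -
    have "{1..n} = {1..m} \<union> {Suc m..n}" using assms by auto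
    hence "(\<Sum>i=1..n. cis (\<theta> * x i)) = (\<Sum>i=1..m. cis (\<theta> * x i)) + (\<Sum>i=Suc m..n. cis (\<theta> * x i))"
      by (simp add: sum.union_disjoint)
    thus ?thesis using assms by (simp add: urn_char_def)
  qed
  hence "of_nat n * (urn_char x n \<theta> - urn_char x m \<theta>)
    = (\<Sum>i=Suc m..n. cis (\<theta> * x i)) - of_real (real n - real m) * urn_char x m \<theta>"
    by (simp add: algebra_simps)
  hence "real n * cmod (urn_char x n \<theta> - urn_char x m \<theta>)
    = cmod ((\<Sum>i=Suc m..n. cis (\<theta> * x i)) - of_real (real n - real m) * urn_char x m \<theta>)"
    by (metis norm_mult norm_of_nat)
  also have "\<dots> \<le> cmod (\<Sum>i=Suc m..n. cis (\<theta> * x i)) + cmod (of_real (real n - real m) * urn_char x m \<theta>)"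
    by (rule norm_triangle_ineq4)
  also have "\<dots> \<le> (real n - real m) + (real n - real m) * 1"
  proof (rule add_mono)
    have "cmod (\<Sum>i=Suc m..n. cis (\<theta> * x i)) \<le> (\<Sum>i=Suc m..n. 1)"
      by (rule sum_norm_le) simp
    thus "cmod (\<Sum>i=Suc m..n. cis (\<theta> * x i)) \<le> real n - real m" using assms by simp
    have "cmod (of_real (real n - real m) * urn_char x m \<theta>) = (real n - real m) * cmod (urn_char x m \<theta>)"
      using assms by (simp add: norm_mult del: of_real_diff)
    also have "\<dots> \<le> (real n - real m) * 1"
      using assms by (intro mult_left_mono norm_urn_char_le_1) auto
    finally show "cmod (of_real (real n - real m) * urn_char x m \<theta>) \<le> (real n - real m) * 1" .
  qed
  finally have "cmod (urn_char x n \<theta> - urn_char x m \<theta>) \<le> 2 * (real n - real m) / real n"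
    using n by (simp add: pos_le_divide_eq mult.commute)
  also have "\<dots> \<le> 2 * (real n - real m) / real m"
    using assms m by (intro divide_left_mono) auto
  finally show ?thesis .
qed

lemma urn_char_tendsto_interpolate:
  assumes Y: "\<forall>\<^sub>F n in sequentially. abs_sum n x \<le> K * (real n)\<^sup>2"
    and sub: "(\<lambda>L. urn_char x (L ^ 16) (t / real L ^ 16)) \<longlonglongrightarrow> c"
  shows "(\<lambda>n. urn_char x n (t / real n)) \<longlonglongrightarrow> c"
proof -
  define gap where "gap = (\<lambda>L::nat. (1 + 1 / real L) ^ 16 - 1)"
  have inv: "(\<lambda>L. 1 / real L) \<longlonglongrightarrow> 0" by (rule lim_1_over_n)
  have "gap \<longlonglongrightarrow> (1 + 0) ^ 16 - 1"
    unfolding gap_def by (intro tendsto_intros inv)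
  hence "(\<lambda>L. (\<bar>t\<bar> * \<bar>K\<bar> + 2) * gap L + cmod (urn_char x (L ^ 16) (t / real L ^ 16) - c))
      \<longlonglongrightarrow> (\<bar>t\<bar> * \<bar>K\<bar> + 2) * 0 + 0"
    by (intro tendsto_intros tendsto_norm_zero LIM_zero sub) simp
  hence lim: "(\<lambda>L. (\<bar>t\<bar> * \<bar>K\<bar> + 2) * gap L + cmod (urn_char x (L ^ 16) (t / real L ^ 16) - c)) \<longlonglongrightarrow> 0"
    by simp
  obtain n0 where n0: "\<And>n. n0 \<le> n \<Longrightarrow> abs_sum n x \<le> K * (real n)\<^sup>2"
    using Y by (auto simp: eventually_sequentially)
  show ?thesis
  proof (rule LIMSEQ_I)
    fix e :: real assume "e > 0"
    from order_tendstoD(2)[OF lim this] obtain L0 where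
      L0: "\<And>L. L0 \<le> L \<Longrightarrow> (\<bar>t\<bar> * \<bar>K\<bar> + 2) * gap L + cmod (urn_char x (L ^ 16) (t / real L ^ 16) - c) < e"
      by (auto simp: eventually_sequentially)
    show "\<exists>n1. \<forall>n\<ge>n1. cmod (urn_char x n (t / real n) - c) < e"
    proof (intro exI[of _ "Suc L0 ^ 16 + n0"] allI impI)
      fix n assume n: "Suc L0 ^ 16 + n0 \<le> n"
      obtain L where L: "L ^ 16 \<le> n" "n < Suc L ^ 16" using exists_power_bracket[of 16 n] by auto
      have "Suc L0 ^ 16 < Suc L ^ 16" using n L by simp
      hence "L0 < L" using power_less_imp_less_base by fastforce
      define m where "m = L ^ 16"
      have m: "1 \<le> m" "m \<le> n" using L \<open>L0 < L\<close> by (auto simp: m_def Suc_le_eq)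
      hence rm: "real m > 0" "real n > 0" "real m \<le> real n" by auto
      \<comment> \<open>Both the change of frequency and the added balls cost at most a multiple of the
        relative gap between \<open>m\<close> and \<open>n\<close>.\<close>
      have gap: "(real n - real m) / real m \<le> gap L"
      proof -
        have "real n \<le> real (Suc L) ^ 16" using L by (metis less_imp_le of_nat_le_iff of_nat_power)
        hence "real n / real m \<le> real (Suc L) ^ 16 / real m" using rm by (intro divide_right_mono) auto
        also have "\<dots> = (1 + 1 / real L) ^ 16"
          using \<open>L0 < L\<close> by (simp add: m_def field_simps flip: power_divide)
        finally show ?thesis using rm by (simp add: gap_def diff_divide_distrib)
      qed
      have "cmod (urn_char x n (t / n) - urn_char x n (t / m)) \<le> \<bar>t\<bar> * \<bar>K\<bar> * ((real n - real m) / real m)"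
      proof -
        have "cmod (urn_char x n (t / n) - urn_char x n (t / m)) \<le> \<bar>t / n - t / m\<bar> * abs_sum n x / n"
          by (rule norm_urn_char_diff_le)
        also have "\<dots> \<le> \<bar>t / n - t / m\<bar> * (\<bar>K\<bar> * (real n)\<^sup>2) / n"
        proof (intro divide_right_mono mult_left_mono)
          have "K * (real n)\<^sup>2 \<le> \<bar>K\<bar> * (real n)\<^sup>2" by (intro mult_right_mono) auto
          thus "abs_sum n x \<le> \<bar>K\<bar> * (real n)\<^sup>2" using n0[of n] n by linarith
        qed auto
        also have "\<bar>t / n - t / m\<bar> = \<bar>t\<bar> * ((real n - real m) / (real n * real m))"
        proof -
          have "t / n - t / m = - (t * ((real n - real m) / (real n * real m)))"
            using rm by (simp add: field_simps)
          thus ?thesis using rm by (simp add: abs_mult)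
        qed
        also have "\<bar>t\<bar> * ((real n - real m) / (real n * real m)) * (\<bar>K\<bar> * (real n)\<^sup>2) / n
           = \<bar>t\<bar> * \<bar>K\<bar> * ((real n - real m) / real m)"
          using rm by (simp add: power2_eq_square)
        finally show ?thesis .
      qed
      moreover have "cmod (urn_char x n (t / m) - urn_char x m (t / m)) \<le> 2 * ((real n - real m) / real m)"
        using norm_urn_char_grow[OF m, of x "t / m"] by simp
      moreover have "cmod (urn_char x n (t / n) - c) \<le> cmod (urn_char x n (t / n) - urn_char x n (t / m))
        + cmod (urn_char x n (t / m) - urn_char x m (t / m)) + cmod (urn_char x m (t / m) - c)"
        by norm
      ultimately have "cmod (urn_char x n (t / n) - c)
         \<le> (\<bar>t\<bar> * \<bar>K\<bar> + 2) * ((real n - real m) / real m) + cmod (urn_char x m (t / m) - c)"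
        unfolding distrib_right by linarith
      also have "\<dots> \<le> (\<bar>t\<bar> * \<bar>K\<bar> + 2) * gap L + cmod (urn_char x m (t / m) - c)"
        by (intro add_right_mono mult_left_mono gap) auto
      also have "\<dots> < e" using L0[of L] \<open>L0 < L\<close> by (simp add: m_def)
      finally show "cmod (urn_char x n (t / n) - c) < e" .
    qed
  qed
qed

text \<open>
  The functions of \<open>t\<close> are Lipschitz uniformly in \<open>n\<close>, by the linear growth of the mean absolute label.
\<close>

lemma urn_char_tendsto_all:
  assumes Y: "\<forall>\<^sub>F n in sequentially. abs_sum n x \<le> K * (real n)\<^sup>2"
    and rat: "\<And>s. s \<in> \<rat> \<Longrightarrow> (\<lambda>n. urn_char x n (s / real n)) \<longlonglongrightarrow> limit_char (A * s)"
  shows "(\<lambda>n. urn_char x n (t / real n)) \<longlonglongrightarrow> limit_char (A * t)"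
proof (rule LIMSEQ_I)
  fix e :: real assume e: "e > 0"
  define B where "B = \<bar>K\<bar> + \<bar>A\<bar> + 1"
  define d where "d = e / (2 * B)"
  have B: "B > 0" by (simp add: B_def)
  have d: "d > 0" using e B by (simp add: d_def)
  obtain s where s: "s \<in> \<rat>" "t < s" "s < t + d" using Rats_dense_in_real[of t "t + d"] d by auto
  have "(\<bar>K\<bar> + \<bar>A\<bar>) * \<bar>t - s\<bar> \<le> B * d"
    using s by (intro mult_mono) (auto simp: B_def)
  also have "\<dots> = e / 2" using B by (simp add: d_def)
  finally have small: "(\<bar>K\<bar> + \<bar>A\<bar>) * \<bar>t - s\<bar> \<le> e / 2" .
  obtain n0 where n0: "\<And>n. n0 \<le> n \<Longrightarrow> abs_sum n x \<le> K * (real n)\<^sup>2"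
    using Y by (auto simp: eventually_sequentially)
  from LIMSEQ_D[OF rat[OF s(1)], of "e / 2"] e obtain n1 where
    n1: "\<And>n. n1 \<le> n \<Longrightarrow> cmod (urn_char x n (s / real n) - limit_char (A * s)) < e / 2" by auto
  show "\<exists>no. \<forall>n\<ge>no. cmod (urn_char x n (t / real n) - limit_char (A * t)) < e"
  proof (intro exI[of _ "Suc (n0 + n1)"] allI impI)
    fix n assume n: "Suc (n0 + n1) \<le> n"
    have "cmod (urn_char x n (t / n) - urn_char x n (s / n)) \<le> \<bar>t / n - s / n\<bar> * abs_sum n x / n"
      by (rule norm_urn_char_diff_le)
    also have "\<dots> \<le> \<bar>t / n - s / n\<bar> * (\<bar>K\<bar> * (real n)\<^sup>2) / n"
    proof (intro divide_right_mono mult_left_mono)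
      have "K * (real n)\<^sup>2 \<le> \<bar>K\<bar> * (real n)\<^sup>2" by (intro mult_right_mono) auto
      thus "abs_sum n x \<le> \<bar>K\<bar> * (real n)\<^sup>2" using n0[of n] n by linarith
    qed auto
    also have "\<dots> = \<bar>K\<bar> * \<bar>t - s\<bar>"
      using n by (simp add: power2_eq_square flip: diff_divide_distrib)
    finally have 1: "cmod (urn_char x n (t / n) - urn_char x n (s / n)) \<le> \<bar>K\<bar> * \<bar>t - s\<bar>" .
    have 2: "cmod (limit_char (A * s) - limit_char (A * t)) \<le> \<bar>A\<bar> * \<bar>t - s\<bar>"
    proof -
      have "cmod (limit_char (A * s) - limit_char (A * t))
        = \<bar>A * s - A * t\<bar> * (cmod (limit_char (A * s)) * cmod (limit_char (A * t)))"
        unfolding limit_char_diff by (simp only: norm_mult norm_ii norm_of_real mult_1 mult.assoc)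
      also have "\<dots> \<le> \<bar>A * s - A * t\<bar> * (1 * 1)"
        by (intro mult_left_mono mult_mono norm_limit_char_le_1) auto
      also have "\<dots> = \<bar>A\<bar> * \<bar>t - s\<bar>" by (simp add: abs_minus_commute flip: right_diff_distrib abs_mult)
      finally show ?thesis .
    qed
    have "cmod (urn_char x n (t / n) - limit_char (A * t)) \<le> cmod (urn_char x n (t / n) - urn_char x n (s / n))
      + cmod (urn_char x n (s / n) - limit_char (A * s)) + cmod (limit_char (A * s) - limit_char (A * t))"
      by norm
    thus "cmod (urn_char x n (t / n) - limit_char (A * t)) < e"
      using 1 2 n1[of n] n small by (simp add: distrib_right)
  qed
qed

section \<open>Weak convergence of the scaled draws\<close>

lemma char_scaled_exp_law: "char (scaled_exp_law a) t = limit_char (a * t)"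
proof -
  define \<rho> where "\<rho> = exponential_density 1"
  define b where "b = a * t"
  define f where "f = (\<lambda>u::real. exp (- u) *\<^sub>R iexp (b * u))"
  \<comment> \<open>\<open>F\<close> is an antiderivative of \<open>f\<close>, since \<open>limit_char b\<close> inverts \<open>1 - \<i> * b\<close>.\<close>
  define F where "F = (\<lambda>u::real. - limit_char b * (exp (- u) *\<^sub>R iexp (b * u)))"
  interpret E: prob_space "density lborel \<rho>"
    unfolding \<rho>_def by (rule prob_space_exponential_density) simp
  have [measurable]: "\<rho> \<in> borel_measurable borel" by (simp add: \<rho>_def)
  have \<rho>0: "\<rho> u \<ge> 0" for u by (simp add: \<rho>_def exponential_density_def)
  have \<rho>_eq: "\<rho> u *\<^sub>R iexp (b * u) = indicator {0<..} u *\<^sub>R f u" if "u \<noteq> 0" for u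
    using that by (auto simp: \<rho>_def f_def exponential_density_def)
  have AE0: "AE u in lborel. u \<noteq> (0::real)"
    by (rule AE_lborel_singleton)
  have [measurable]: "f \<in> borel_measurable borel" unfolding f_def by measurable
  have ae: "AE u in lborel. \<rho> u *\<^sub>R iexp (b * u) = indicator {0<..} u *\<^sub>R f u"
    using AE0 by eventually_elim (rule \<rho>_eq)
  have int_\<rho>: "integrable lborel (\<lambda>u. \<rho> u *\<^sub>R iexp (b * u))"
  proof -
    have "integrable (density lborel \<rho>) (\<lambda>u. iexp (b * u))"
      by (intro E.integrable_const_bound[where B = 1]) auto
    thus ?thesis by (subst (asm) integrable_density) (auto simp: \<rho>0)
  qed
  have int_f: "set_integrable lborel {0<..} f"
    unfolding set_integrable_def
    by (rule integrable_cong_AE[THEN iffD1, OF _ _ ae int_\<rho>]) measurable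
  have "char (scaled_exp_law a) t = (CLINT u|density lborel \<rho>. iexp (b * u))"
    by (simp add: char_def scaled_exp_law_def integral_distr b_def \<rho>_def mult_ac)
  also have "\<dots> = (CLINT u|lborel. \<rho> u *\<^sub>R iexp (b * u))"
    by (subst integral_density) (auto simp: \<rho>0)
  also have "\<dots> = (CLINT u:{0<..}|lborel. f u)"
    unfolding set_lebesgue_integral_def
    by (rule integral_cong_AE[OF _ _ ae]) measurable
  also have "\<dots> = (CLBINT u=0..\<infinity>. f u)"
    by (simp add: interval_lebesgue_integral_0_infty)
  also have "\<dots> = 0 - (- limit_char b)"
  proof (rule interval_integral_FTC_integrable)
    fix u :: real
    show "(F has_vector_derivative f u) (at u)"
    proof -
      have "((\<lambda>u. exp (- u) *\<^sub>R iexp (b * u)) has_vector_derivative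
          (exp (- u) *\<^sub>R (\<i> * b * iexp (b * u)) + (- exp (- u)) *\<^sub>R iexp (b * u))) (at u)"
        by (auto intro!: derivative_eq_intros has_vector_derivative_scaleR
            has_vector_derivative_real_field simp: field_simps scaleR_conv_of_real)
      hence "(F has_vector_derivative (- limit_char b *
          (exp (- u) *\<^sub>R (\<i> * b * iexp (b * u)) + (- exp (- u)) *\<^sub>R iexp (b * u)))) (at u)"
        unfolding F_def by (rule has_vector_derivative_mult_right)
      moreover have "- limit_char b * (exp (- u) *\<^sub>R (\<i> * b * iexp (b * u)) + (- exp (- u)) *\<^sub>R iexp (b * u))
          = limit_char b * (1 - \<i> * b) * f u"
        by (simp add: f_def scaleR_conv_of_real algebra_simps)
      moreover have "limit_char b * (1 - \<i> * b) = 1"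
        using one_minus_imaginary_nonzero[of b] by (simp add: limit_char_def)
      ultimately show ?thesis by simp
    qed
    show "isCont f u" unfolding f_def by (intro continuous_intros)
  next
    show "set_integrable lborel (einterval 0 \<infinity>) f"
      using int_f by (simp add: zero_ereal_def)
  next
    have "isCont F 0" unfolding F_def by (intro continuous_intros)
    hence "(F \<longlongrightarrow> F 0) (at_right 0)" by (simp add: continuous_within filterlim_at_split)
    thus "((F \<circ> real_of_ereal) \<longlongrightarrow> - limit_char b) (at_right 0)"
      unfolding zero_ereal_def by (simp add: ereal_tendsto_simps F_def)
  next
    have "(F \<longlongrightarrow> 0) at_top"
    proof (rule Lim_null_comparison)
      show "\<forall>\<^sub>F u in at_top. norm (F u) \<le> exp (- u)"
      proof (rule always_eventually, rule allI)
        fix u :: real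
        have "norm (F u) = cmod (limit_char b) * exp (- u)" by (simp add: F_def norm_mult)
        also have "\<dots> \<le> 1 * exp (- u)" by (intro mult_right_mono norm_limit_char_le_1) simp
        finally show "norm (F u) \<le> exp (- u)" by simp
      qed
      show "((\<lambda>u::real. exp (- u)) \<longlongrightarrow> 0) at_top"
        by (rule filterlim_compose[OF exp_at_bot filterlim_uminus_at_bot_at_top])
    qed
    thus "((F \<circ> real_of_ereal) \<longlongrightarrow> 0) (at_left \<infinity>)"
      by (simp add: ereal_tendsto_simps)
  qed simp_all
  finally show ?thesis by (simp add: b_def)
qed

lemma real_distribution_scaled_exp_law: "real_distribution (scaled_exp_law a)"
proof -
  interpret prob_space "density lborel (exponential_density 1)"
    by (rule prob_space_exponential_density) simp
  show ?thesis unfolding scaled_exp_law_def by (rule real_distribution_distr) simp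
qed

lemma real_distribution_scaled_draw_law: "real_distribution (scaled_draw_law x n)"
  unfolding scaled_draw_law_def
  by (rule prob_space.real_distribution_distr[OF prob_space_measure_pmf]) simp

lemma expectation_empirical:
  fixes f :: "int \<Rightarrow> 'b::{banach, second_countable_topology}"
  assumes "n \<ge> 1"
  shows "(LINT z|measure_pmf (empirical x n). f z) = (\<Sum>i=1..n. f (x i)) /\<^sub>R real n"
  using assms unfolding empirical_def
  by (subst integral_map_pmf, subst integral_measure_pmf[of "{1..n}"])
     (auto simp: scaleR_sum_right divide_inverse)

lemma char_scaled_draw_law:
  assumes "n \<ge> 1"
  shows "char (scaled_draw_law x n) t = urn_char x n (t / n)"
proof -
  have "char (scaled_draw_law x n) t = (CLINT z|measure_pmf (empirical x n). cis (t / n * z))"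
    by (simp add: char_def scaled_draw_law_def integral_distr cis_conv_exp)
  thus ?thesis
    using assms by (simp add: expectation_empirical urn_char_def scaleR_conv_of_real divide_inverse mult_ac)
qed

lemma weak_conv_scaled_draw_law:
  assumes "\<And>t. (\<lambda>n. urn_char x n (t / real n)) \<longlonglongrightarrow> limit_char (A * t)"
  shows "weak_conv_m (scaled_draw_law x) (scaled_exp_law A)"
proof (rule levy_continuity[OF real_distribution_scaled_draw_law real_distribution_scaled_exp_law])
  fix t
  have "\<forall>\<^sub>F n in sequentially. urn_char x n (t / real n) = char (scaled_draw_law x n) t"
    using eventually_ge_at_top[of 1] by eventually_elim (simp add: char_scaled_draw_law)
  from Lim_transform_eventually[OF assms this]
  show "(\<lambda>n. char (scaled_draw_law x n) t) \<longlonglongrightarrow> char (scaled_exp_law A) t"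
    by (simp add: char_scaled_exp_law)
qed

lemma draw_mean_eq: "n \<ge> 1 \<Longrightarrow> draw_mean x n = label_sum n x / n"
  by (simp add: draw_mean_def expectation_empirical label_sum_def divide_inverse)

lemma eventually_draw_mean_slope:
  "\<forall>\<^sub>F n in sequentially. draw_mean x n / real (n + 1) = slope n x"
  using eventually_ge_at_top[of 1] by eventually_elim (simp add: draw_mean_eq slope_def)

lemma tendsto_draw_mean_iff_slope:
  "(\<lambda>n. draw_mean x n / real (n + 1)) \<longlonglongrightarrow> L \<longleftrightarrow> (\<lambda>n. slope n x) \<longlonglongrightarrow> L"
  by (rule tendsto_cong[OF eventually_draw_mean_slope])

lemma urn_slope_eq_lim: "urn_slope x = lim (\<lambda>n. slope n x)"
  unfolding urn_slope_def lim_def tendsto_draw_mean_iff_slope ..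

context Z_urn
begin

lemma AE_draw_mean_convergent:
  "AE \<omega> in M. convergent (\<lambda>n. draw_mean (path \<omega>) n / real (n + 1))"
  using AE_slope_convergent unfolding convergent_def tendsto_draw_mean_iff_slope .

lemma prob_urn_slope_nonzero:
  assumes "\<exists>i\<in>{1..\<tau>\<^sub>0}. x\<^sub>0 i \<noteq> 0"
  shows "0 < prob {\<omega> \<in> space M. urn_slope (path \<omega>) \<noteq> 0}"
proof (rule ccontr)
  assume "\<not> ?thesis"
  hence zero: "prob {\<omega> \<in> space M. urn_slope (path \<omega>) \<noteq> 0} = 0"
    using measure_nonneg[of M] by (simp add: not_less antisym)
  have [measurable]: "(\<lambda>\<omega>. slope n (path \<omega>)) \<in> borel_measurable M" for n
    by (rule measurable_path_depends[OF depends_on_slope])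
  have "{\<omega> \<in> space M. urn_slope (path \<omega>) \<noteq> 0} \<in> sets M"
    unfolding urn_slope_eq_lim by measurable
  with zero have "AE \<omega> in M. urn_slope (path \<omega>) = 0"
    by (subst (asm) prob_eq_0) (auto elim: AE_mp)
  with AE_slope_convergent have "AE \<omega> in M. (\<lambda>n. slope n (path \<omega>)) \<longlonglongrightarrow> 0"
  proof eventually_elim
    case (elim \<omega>)
    thus ?case by (metis convergent_LIMSEQ_iff urn_slope_eq_lim)
  qed
  thus False using not_AE_slope_tendsto_0[OF assms] by simp
qed

lemma AE_weak_conv_scaled_draw_law:
  "AE \<omega> in M. weak_conv_m (scaled_draw_law (path \<omega>)) (scaled_exp_law (urn_slope (path \<omega>)))"
proof -
  have noise: "AE \<omega> in M. \<forall>t\<in>\<rat>. \<forall>\<^sub>F L in sequentially. \<forall>n\<in>{L ^ 13..L ^ 16}.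
      \<bar>noise_sum (\<lambda>_ z. g (t / real L ^ 16 * real_of_int z)) (L ^ 13) n (path \<omega>)\<bar> \<le> real L ^ 9"
    if "\<And>u. \<bar>g u\<bar> \<le> 1" for g :: "real \<Rightarrow> real"
    using that countable_rat by (subst AE_ball_countable) (auto intro!: AE_bounded_noise_eventually_le)
  have "AE \<omega> in M. \<forall>t\<in>\<rat>. \<forall>\<^sub>F L in sequentially. \<forall>n\<in>{L ^ 13..L ^ 16}.
      \<bar>noise_sum (\<lambda>_ z. cos (t / real L ^ 16 * real_of_int z)) (L ^ 13) n (path \<omega>)\<bar> \<le> real L ^ 9"
    by (rule noise) simp
  moreover have "AE \<omega> in M. \<forall>t\<in>\<rat>. \<forall>\<^sub>F L in sequentially. \<forall>n\<in>{L ^ 13..L ^ 16}.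
      \<bar>noise_sum (\<lambda>_ z. sin (t / real L ^ 16 * real_of_int z)) (L ^ 13) n (path \<omega>)\<bar> \<le> real L ^ 9"
    by (rule noise) simp
  ultimately show ?thesis
    using AE_slope_convergent AE_abs_sum_bounded AE_square_sum_eventually_le
  proof eventually_elim
    case (elim \<omega>)
    let ?A = "urn_slope (path \<omega>)"
    obtain K where K: "\<forall>\<^sub>F n in sequentially. abs_sum n (path \<omega>) \<le> K * (real n)\<^sup>2"
      using elim(4) by blast
    have A: "(\<lambda>n. label_sum n (path \<omega>) / (real n * (real n + 1))) \<longlonglongrightarrow> ?A"
      using elim(3) unfolding urn_slope_eq_lim slope_def[symmetric] convergent_LIMSEQ_iff .
    have "(\<lambda>n. urn_char (path \<omega>) n (t / real n)) \<longlonglongrightarrow> limit_char (?A * t)" if "t \<in> \<rat>" for t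
      by (rule urn_char_tendsto_interpolate[OF K], rule urn_char_tendsto_along_powers[OF A elim(5)])
         (use elim(1,2) that in auto)
    hence "(\<lambda>n. urn_char (path \<omega>) n (t / real n)) \<longlonglongrightarrow> limit_char (?A * t)" for t
      by (rule urn_char_tendsto_all[OF K])
    thus ?case by (rule weak_conv_scaled_draw_law)
  qed
qed

end

theorem theorem1p1:
  fixes M :: "'a measure"
    and \<tau>\<^sub>0 :: nat
    and x\<^sub>0 :: "nat \<Rightarrow> int"
    and D :: "nat \<Rightarrow> bool \<Rightarrow> 'a \<Rightarrow> nat"
    and X :: "nat \<Rightarrow> 'a \<Rightarrow> int"
  assumes "Z_urn M \<tau>\<^sub>0 x\<^sub>0 D X"
  shows "(AE \<omega> in M. convergent (\<lambda>n. draw_mean (\<lambda>i. X i \<omega>) n / real (n + 1)))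
    \<and> ((\<exists>i\<in>{1..\<tau>\<^sub>0}. x\<^sub>0 i \<noteq> 0) \<longrightarrow>
         0 < measure M {\<omega> \<in> space M. urn_slope (\<lambda>i. X i \<omega>) \<noteq> 0})
    \<and> (AE \<omega> in M. weak_conv_m (scaled_draw_law (\<lambda>i. X i \<omega>))
         (scaled_exp_law (urn_slope (\<lambda>i. X i \<omega>))))"
proof -
  interpret Z_urn M \<tau>\<^sub>0 x\<^sub>0 D X by fact
  show ?thesis
    using AE_draw_mean_convergent prob_urn_slope_nonzero AE_weak_conv_scaled_draw_law
    unfolding path_def by blast
qed

end
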